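(* Let $\alpha>0$, let $\nu\in\mathcal{P}_+$, and let $R(t)=\mathbf{E}N(t)$ be the renewal function of the renewal process for the Kendall convolution $\vartriangle_\alpha$ with unit step distribution $\nu$. Suppose that the cumulative distribution function $F$ of $\nu$ is differentiable with density $f=F'$, that $m(\alpha)<\infty$, and that $xH'(x)\to0$ as $x\to\infty$. Then for every $h>0$ $$\lim_{t\to\infty}\left(\frac{R(t+h)}{(t+h)^{\alpha-1}}-\frac{R(t)}{t^{\alpha-1}}\right)=\frac{2h}{m(\alpha)}.$$
   Context: $\mathcal{P}_+$ is the set of Borel probability measures on $[0,\infty)$. For $\alpha>0$ the Kendall convolution $\vartriangle_\alpha$ is the commutative, associative operation on $\mathcal{P}_+$ given by $\delta_x\vartriangle_\alpha\delta_1=(1-x^\alpha)\delta_1+x^\alpha\pi_{2\alpha}$ for $x\in[0,1]$, where $\pi_{2\alpha}(dy)=2\alpha y^{-2\alpha-1}\mathbf{1}_{[1,\infty)}(y)\,dy$; by scaling, for $0\le x\le y$, $y>0$, $\delta_x\vartriangle_\alpha\delta_y$ is the law of $yX$ where $X$ has law $\delta_{x/y}\vartriangle_\alpha\delta_1$; $\delta_0\vartriangle_\alpha\delta_0=\delta_0$; and $(\lambda_1\vartriangle_\alpha\lambda_2)(A)=\int\int(\delta_x\vartriangle_\alpha\delta_y)(A)\,\lambda_1(dx)\lambda_2(dy)$. $\nu^{\vartriangle_\alpha n}$ is the $n$-fold convolution power. The Kendall random walk with step distribution $\nu$ is the Markov process $(S_n)_{n\ge1}$ with $\mathcal{L}(S_1)=\nu$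 and $P(S_n\in\cdot\mid S_k=x)=\delta_x\vartriangle_\alpha\nu^{\vartriangle_\alpha(n-k)}$ for $k<n$. The renewal process is $N(t)=\inf\{n\ge0:S_{n+1}>t\}$ ($=\infty$ if no such $n$ exists). $F(t)=\nu([0,t])$; differentiability of $F$ is meant on $(0,\infty)$, and $f$ is the Lebesgue density of $\nu$. $H(t)=\int_0^t x^\alpha f(x)\,dx$, so $H'(t)=t^\alpha f(t)$; $m(\alpha)=\int_0^\infty x^\alpha\,\nu(dx)$. *)

theory Defs
  imports "HOL-Probability.Probability"
begin

definition prob_nonneg :: "real measure set" where
  "prob_nonneg = {\<nu>. prob_space \<nu> \<and> sets \<nu> = sets borel \<and> emeasure \<nu> {..<0} = 0}"

definition pareto :: "real \<Rightarrow> real measure" where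
  "pareto \<alpha> = density lborel (\<lambda>y. ennreal (2 * \<alpha> * y powr (- 2 * \<alpha> - 1)) * indicator {1..} y)"

text \<open>The mixture of a point mass at 1 and the Pareto law (for \<open>x\<close> in the unit interval) is
  written as a Bernoulli bind; \<open>emeasure_kendall_unit\<close> below gives its explicit form.\<close>

definition kendall_unit :: "real \<Rightarrow> real \<Rightarrow> real measure" where
  "kendall_unit \<alpha> x =
     measure_pmf (bernoulli_pmf (x powr \<alpha>)) \<bind> (\<lambda>b. if b then pareto \<alpha> else return borel 1)"

text \<open>Convolution of the point masses at \<open>x\<close> and \<open>y\<close>, symmetric in the two arguments.  Only
  nonnegative arguments are relevant.\<close>

definition kendall_point :: "real \<Rightarrow> real \<Rightarrow> real \<Rightarrow> real measure" where
  "kendall_point \<alpha> x y =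
     (if max x y = 0 then return borel 0
      else distr (kendall_unit \<alpha> (min x y / max x y)) borel (\<lambda>z. max x y * z))"

definition kendall_conv :: "real \<Rightarrow> real measure \<Rightarrow> real measure \<Rightarrow> real measure" where
  "kendall_conv \<alpha> \<mu> \<kappa> = \<mu> \<bind> (\<lambda>x. \<kappa> \<bind> (\<lambda>y. kendall_point \<alpha> x y))"

primrec kendall_power :: "real \<Rightarrow> real measure \<Rightarrow> nat \<Rightarrow> real measure" where
  "kendall_power \<alpha> \<nu> 0 = return borel 0"
| "kendall_power \<alpha> \<nu> (Suc n) = kendall_conv \<alpha> \<nu> (kendall_power \<alpha> \<nu> n)"

definition history :: "'a measure \<Rightarrow> (nat \<Rightarrow> 'a \<Rightarrow> real) \<Rightarrow> nat \<Rightarrow> 'a measure" where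
  "history M S k = sigma (space M) (\<Union>i\<in>{1..k}. {S i -` A \<inter> space M | A. A \<in> sets borel})"

text \<open>The walk is indexed by \<open>n \<ge> 1\<close>; the value \<open>S 0\<close> plays no role.  The last conjunct is the
  Markov property with respect to the natural filtration together with the transition law.\<close>

definition kendall_random_walk ::
  "real \<Rightarrow> real measure \<Rightarrow> 'a measure \<Rightarrow> (nat \<Rightarrow> 'a \<Rightarrow> real) \<Rightarrow> bool" where
  "kendall_random_walk \<alpha> \<nu> M S \<longleftrightarrow>
     prob_space M \<and>
     (\<forall>n\<ge>1. S n \<in> borel_measurable M) \<and>
     distr M borel (S 1) = \<nu> \<and>
     (\<forall>k n. 1 \<le> k \<longrightarrow> k < n \<longrightarrow> (\<forall>A\<in>sets borel. AE \<omega> in M.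
        real_cond_exp M (history M S k) (\<lambda>\<omega>'. indicator A (S n \<omega>')) \<omega> =
        measure (kendall_conv \<alpha> (return borel (S k \<omega>)) (kendall_power \<alpha> \<nu> (n - k))) A))"

text \<open>The infimum of the empty set is \<open>\<infinity>\<close> in \<^typ>\<open>enat\<close>.\<close>

definition renewal_process :: "(nat \<Rightarrow> 'a \<Rightarrow> real) \<Rightarrow> real \<Rightarrow> 'a \<Rightarrow> enat" where
  "renewal_process S t \<omega> = (INF n\<in>{n. S (Suc n) \<omega> > t}. enat n)"

text \<open>The expectation may a priori be infinite.  In \<^typ>\<open>ereal\<close>, subtraction with an infinite
  operand is infinite (\<open>\<infinity> - \<infinity> = \<infinity>\<close>), so a finite limit of differences of such values entails
  that they are eventually finite.\<close>

definition renewal_function :: "'a measure \<Rightarrow> (nat \<Rightarrow> 'a \<Rightarrow> real) \<Rightarrow> real \<Rightarrow> ennreal" where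
  "renewal_function M S t = (\<integral>\<^sup>+\<omega>. ennreal_of_enat (renewal_process S t \<omega>) \<partial>M)"

definition moment :: "real \<Rightarrow> real measure \<Rightarrow> ennreal" where
  "moment \<alpha> \<nu> = (\<integral>\<^sup>+x. ennreal (x powr \<alpha>) * indicator {0..} x \<partial>\<nu>)"

definition trunc_moment :: "real \<Rightarrow> (real \<Rightarrow> real) \<Rightarrow> real \<Rightarrow> real" where
  "trunc_moment \<alpha> f t = (LINT x:{0..t}|lborel. x powr \<alpha> * f x)"


lemma sets_pareto [simp, measurable_cong]: "sets (pareto \<alpha>) = sets borel"
  by (simp add: pareto_def)

lemma prob_space_pareto:
  assumes "\<alpha> > 0"
  shows "prob_space (pareto \<alpha>)"
proof
  have lim: "((\<lambda>y. - (y powr (- 2 * \<alpha>))) \<longlongrightarrow> 0) at_top"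
    using tendsto_minus[OF tendsto_neg_powr[of "- 2 * \<alpha>" "\<lambda>x::real. x" at_top]] assms
    by (simp add: filterlim_ident)
  have "emeasure (pareto \<alpha>) (space (pareto \<alpha>)) =
      (\<integral>\<^sup>+y. ennreal (2 * \<alpha> * y powr (- 2 * \<alpha> - 1)) * indicator {1..} y \<partial>lborel)"
    unfolding pareto_def by (subst emeasure_density) (auto simp: space_density)
  also have "\<dots> = ennreal (0 - (- (1 powr (- 2 * \<alpha>))))"
  proof (rule nn_integral_FTC_atLeast[OF _ _ _ lim])
    fix x :: real assume "1 \<le> x"
    then show "((\<lambda>y. - (y powr (- 2 * \<alpha>))) has_real_derivative 2 * \<alpha> * x powr (- 2 * \<alpha> - 1)) (at x)"
      using assms by (auto intro!: derivative_eq_intros)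
  qed (use assms in auto)
  finally show "emeasure (pareto \<alpha>) (space (pareto \<alpha>)) = 1" by simp
qed

lemma measurable_bernoulli_pmf:
  "(\<lambda>p. measure_pmf (bernoulli_pmf p)) \<in> borel \<rightarrow>\<^sub>M prob_algebra (count_space UNIV)"
proof (intro measurable_prob_algebraI measurable_subprob_algebra)
  fix A :: "bool set"
  have "pmf (bernoulli_pmf p) b = (if b then min 1 (max 0 p) else 1 - min 1 (max 0 p))" for p b
    by (simp add: bernoulli_pmf.rep_eq)
  then show "(\<lambda>p. emeasure (measure_pmf (bernoulli_pmf p)) A) \<in> borel_measurable borel"
    by (simp add: emeasure_measure_pmf_finite)
qed (auto intro: measure_pmf.prob_space_axioms measure_pmf.subprob_space_axioms)

lemma measurable_kendall_unit:
  assumes "\<alpha> > 0"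
  shows "kendall_unit \<alpha> \<in> borel \<rightarrow>\<^sub>M prob_algebra borel"
  unfolding kendall_unit_def
  by (rule measurable_bind_prob_space[OF measurable_compose[OF _ measurable_bernoulli_pmf]])
     (use prob_space_pareto[OF assms] in
       \<open>auto simp: space_prob_algebra split: if_splits intro!: prob_space_return\<close>)

lemma emeasure_kendall_unit:
  assumes "\<alpha> > 0" "0 \<le> x" "x \<le> 1" "A \<in> sets borel"
  shows "emeasure (kendall_unit \<alpha> x) A =
    ennreal (1 - x powr \<alpha>) * indicator A 1 + ennreal (x powr \<alpha>) * emeasure (pareto \<alpha>) A"
proof -
  have x: "x powr \<alpha> \<le> 1"
    using assms by (simp add: powr_le1)
  have "(\<lambda>b. if b then pareto \<alpha> else return borel 1) \<in>
      count_space UNIV \<rightarrow>\<^sub>M subprob_algebra borel"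
    using prob_space_pareto[OF assms(1)]
    by (auto simp: space_subprob_algebra split: if_splits
        intro!: prob_space_imp_subprob_space prob_space_return)
  then show ?thesis
    unfolding kendall_unit_def using x assms(4)
    by (subst emeasure_bind[where N = borel])
       (auto simp: ac_simps cong: measurable_cong_sets)
qed

lemma measurable_kendall_point:
  assumes "\<alpha> > 0"
  shows "(\<lambda>(x, y). kendall_point \<alpha> x y) \<in> borel \<Otimes>\<^sub>M borel \<rightarrow>\<^sub>M prob_algebra borel"
proof -
  note [measurable] = measurable_compose[OF _ measurable_kendall_unit[OF assms]]
  show ?thesis
    unfolding kendall_point_def case_prod_beta by measurable
qed

lemma kendall_conv_prob_algebra:
  assumes "\<alpha> > 0" "\<mu> \<in> space (prob_algebra borel)" "\<kappa> \<in> space (prob_algebra borel)"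
  shows "kendall_conv \<alpha> \<mu> \<kappa> \<in> space (prob_algebra borel)"
    and "A \<in> sets borel \<Longrightarrow> emeasure (kendall_conv \<alpha> \<mu> \<kappa>) A =
      (\<integral>\<^sup>+x. \<integral>\<^sup>+y. emeasure (kendall_point \<alpha> x y) A \<partial>\<kappa> \<partial>\<mu>)"
proof -
  have inner: "(\<lambda>x. \<kappa> \<bind> (\<lambda>y. kendall_point \<alpha> x y)) \<in> borel \<rightarrow>\<^sub>M prob_algebra borel"
    by (rule measurable_bind_prob_space2[OF _ measurable_kendall_point[OF assms(1)]])
       (use assms(3) in simp)
  have point: "kendall_point \<alpha> x \<in> borel \<rightarrow>\<^sub>M prob_algebra borel" for x
    using measurable_compose[OF measurable_Pair1' measurable_kendall_point[OF assms(1)], of x]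
    by simp
  show "kendall_conv \<alpha> \<mu> \<kappa> \<in> space (prob_algebra borel)"
    unfolding kendall_conv_def
    using measurable_bind_prob_space[OF measurable_const[OF assms(2)] inner, of "borel :: real measure"]
    by (auto dest: measurable_space)
  show "emeasure (kendall_conv \<alpha> \<mu> \<kappa>) A =
      (\<integral>\<^sup>+x. \<integral>\<^sup>+y. emeasure (kendall_point \<alpha> x y) A \<partial>\<kappa> \<partial>\<mu>)" if "A \<in> sets borel"
    unfolding kendall_conv_def
    by (simp add: emeasure_bind_prob_algebra[OF assms(2) inner that]
        emeasure_bind_prob_algebra[OF assms(3) point that])
qed

lemma kendall_point_zero:
  assumes "\<alpha> > 0" "x \<ge> 0"
  shows "kendall_point \<alpha> x 0 = return borel x"
proof (cases "x = 0")
  case False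
  have "kendall_unit \<alpha> 0 = return borel 1"
  proof (rule measure_eqI)
    show "sets (kendall_unit \<alpha> 0) = sets (return borel 1)"
      using measurable_space[OF measurable_kendall_unit[OF assms(1)], of 0]
      by (simp add: space_prob_algebra)
    then show "emeasure (kendall_unit \<alpha> 0) A = emeasure (return borel 1) A"
      if "A \<in> sets (kendall_unit \<alpha> 0)" for A
      using that assms(1) by (simp add: emeasure_kendall_unit)
  qed
  then show ?thesis
    using False assms(2) by (simp add: kendall_point_def distr_return)
qed (simp add: kendall_point_def)

lemma kendall_power_one:
  assumes "\<alpha> > 0" "\<nu> \<in> prob_nonneg"
  shows "kendall_power \<alpha> \<nu> 1 = \<nu>"
proof (rule measure_eqI)
  have \<nu>: "\<nu> \<in> space (prob_algebra borel)" "sets \<nu> = sets borel" "emeasure \<nu> {..<0} = 0"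
    using assms(2) by (auto simp: prob_nonneg_def space_prob_algebra)
  have zero: "return borel (0 :: real) \<in> space (prob_algebra borel)"
    by (simp add: space_prob_algebra prob_space_return)
  note conv = kendall_conv_prob_algebra[OF assms(1) \<nu>(1) zero]
  show "sets (kendall_power \<alpha> \<nu> 1) = sets \<nu>"
    using conv(1) \<nu>(2) by (simp add: space_prob_algebra)
  then have sets: "A \<in> sets borel" if "A \<in> sets (kendall_power \<alpha> \<nu> 1)" for A
    using that \<nu>(2) by simp
  have nonneg: "AE x in \<nu>. 0 \<le> x"
    by (rule AE_I[of _ _ "{..<0}"]) (use \<nu> in auto)
  show "emeasure (kendall_power \<alpha> \<nu> 1) A = emeasure \<nu> A"
    if "A \<in> sets (kendall_power \<alpha> \<nu> 1)" for A
  proof -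
    note A = sets[OF that]
    have point: "kendall_point \<alpha> x \<in> borel \<rightarrow>\<^sub>M prob_algebra borel" for x
      using measurable_compose[OF measurable_Pair1' measurable_kendall_point[OF assms(1)], of x]
      by simp
    have "emeasure (kendall_power \<alpha> \<nu> 1) A = (\<integral>\<^sup>+x. emeasure (kendall_point \<alpha> x 0) A \<partial>\<nu>)"
      using A measurable_emeasure_kernel[OF measurable_prob_algebraD[OF point] A]
      by (simp add: conv(2) nn_integral_return)
    also have "\<dots> = (\<integral>\<^sup>+x. indicator A x \<partial>\<nu>)"
      by (rule nn_integral_cong_AE) (use nonneg in eventually_elim, use assms(1) A in
        \<open>simp add: kendall_point_zero\<close>)
    finally show ?thesis using A \<nu>(2) by simp
  qed
qed

end

theory Submission
  imports Defs
begin

text \<open>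
  Fix \<open>t > 0\<close> and put \<open>P \<mu> = \<mu>[0, t]\<close> and \<open>Q \<mu> = \<integral>\<^bsub>[0, t]\<^esub> (x/t)\<^sup>\<alpha> \<mu>(dx)\<close>.  A direct computation
  for point masses shows that the Kendall convolution acts on the pair \<open>(P, Q)\<close> by
  \<open>P = P\<^sub>1P\<^sub>2 - Q\<^sub>1Q\<^sub>2\<close>, \<open>Q = Q\<^sub>1P\<^sub>2 + P\<^sub>1Q\<^sub>2 - 2Q\<^sub>1Q\<^sub>2\<close>; thus \<open>G = P - Q\<close> (the Williamson transform)
  is multiplicative, and the \<open>n\<close>-th power of \<open>\<nu>\<close> gives \<open>[0, t]\<close> the mass \<open>G\<^sup>n + n G\<^sup>n\<^sup>-\<^sup>1 Q\<close>.
  The walk is almost surely nondecreasing, so \<open>N(t) > n\<close> iff \<open>S\<^sub>n\<^sub>+\<^sub>1 \<le> t\<close>, and summation over \<open>n\<close>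
  gives \<open>R(t) = G / (1 - G) + Q / (1 - G)\<^sup>2\<close>.

  With \<open>H(t) = t\<^sup>\<alpha> Q\<close> and \<open>K(t) = t\<^sup>\<alpha> (1 - G) = t\<^sup>\<alpha> (1 - F(t)) + H(t)\<close> this reads
  \<open>R(t) / t\<^sup>\<alpha>\<^sup>-\<^sup>1 = t (1/K + H/K\<^sup>2) - t\<^sup>1\<^sup>-\<^sup>\<alpha>\<close>.  Both \<open>H\<close> and \<open>K\<close> tend to \<open>m(\<alpha>)\<close>, while
  \<open>t K'(t) = \<alpha> t\<^sup>\<alpha> (1 - F(t))\<close> and \<open>t H'(t)\<close> tend to \<open>0\<close>; hence the derivative of the right-hand
  side tends to \<open>2 / m(\<alpha>)\<close>, and the mean value theorem concludes.
\<close>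

section \<open>Truncated moments of Kendall convolutions\<close>

lemma AE_pareto_ge_1: "AE z in pareto \<alpha>. 1 \<le> z"
  unfolding pareto_def
  by (subst AE_density) (auto intro!: AE_I2 simp: indicator_def split: if_splits)

text \<open>With \<gamma> = 2\<alpha> - \<beta> the integrand against Lebesgue measure is a multiple
  of z^(-\<gamma>-1), with a multiple of z^(-\<gamma>) as primitive. It serves for \<beta> = 0 (mass
  of an interval) and \<beta> = \<alpha> (truncated moment).\<close>

lemma nn_integral_pareto_Icc:
  fixes \<alpha> :: real
  assumes "\<beta> < 2 * \<alpha>" "1 \<le> c" "\<alpha> > 0"
  shows "(\<integral>\<^sup>+z. ennreal (z powr \<beta>) * indicator {1..c} z \<partial>pareto \<alpha>) =
    ennreal (2 * \<alpha> / (2 * \<alpha> - \<beta>) * (1 - c powr (\<beta> - 2 * \<alpha>)))"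
proof -
  define \<gamma> where "\<gamma> = 2 * \<alpha> - \<beta>"
  have \<gamma>: "\<gamma> > 0" using assms by (simp add: \<gamma>_def)
  have "(\<integral>\<^sup>+z. ennreal (z powr \<beta>) * indicator {1..c} z \<partial>pareto \<alpha>) =
      (\<integral>\<^sup>+z. ennreal (2 * \<alpha> * z powr (- \<gamma> - 1)) * indicator {1..c} z \<partial>lborel)"
    unfolding pareto_def
    by (subst nn_integral_density)
      (auto intro!: nn_integral_cong simp: indicator_def \<gamma>_def assms(3) less_imp_le
        simp flip: ennreal_mult powr_add, simp add: algebra_simps)
  also have "\<dots> = ennreal (2 * \<alpha> / - \<gamma> * c powr (- \<gamma>) - 2 * \<alpha> / - \<gamma> * 1 powr (- \<gamma>))"
  proof (rule nn_integral_FTC_Icc)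
    fix x :: real assume "x \<in> {1..c}"
    then show "((\<lambda>y. 2 * \<alpha> / - \<gamma> * y powr (- \<gamma>)) has_real_derivative 2 * \<alpha> * x powr (- \<gamma> - 1)) (at x)"
      using \<gamma> by (auto intro!: derivative_eq_intros)
  qed (use assms in auto)
  also have "2 * \<alpha> / - \<gamma> * c powr (- \<gamma>) - 2 * \<alpha> / - \<gamma> * 1 powr (- \<gamma>) = 2 * \<alpha> / \<gamma> * (1 - c powr (- \<gamma>))"
    using \<gamma> by (simp add: field_simps)
  finally show ?thesis by (simp add: \<gamma>_def)
qed

text \<open>Integrates out the Bernoulli variable that chooses between the atom at the maximum and
  the scaled Pareto law. Positivity of the maximum excludes the separately defined convolution of
  two atoms at 0.\<close>

lemma nn_integral_kendall_point:
  assumes "\<alpha> > 0" "x \<ge> 0" "y \<ge> 0" "max x y > 0"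
    and [measurable]: "g \<in> borel_measurable borel"
  shows "(\<integral>\<^sup>+z. g z \<partial>kendall_point \<alpha> x y) =
    ennreal (1 - (min x y / max x y) powr \<alpha>) * g (max x y) +
    ennreal ((min x y / max x y) powr \<alpha>) * (\<integral>\<^sup>+z. g (max x y * z) \<partial>pareto \<alpha>)"
proof -
  let ?u = "min x y / max x y" and ?M = "max x y"
  have u: "0 \<le> ?u" "?u \<le> 1"
    using assms by (auto simp: divide_simps)
  have u1: "?u powr \<alpha> \<le> 1"
    using assms(1) u by (intro powr_le1) auto
  have N: "(\<lambda>b. if b then pareto \<alpha> else return borel 1) \<in>
      measure_pmf (bernoulli_pmf (?u powr \<alpha>)) \<rightarrow>\<^sub>M subprob_algebra borel"
    using prob_space_pareto[OF assms(1)]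
    by (auto simp: space_subprob_algebra split: if_splits
        intro!: prob_space_imp_subprob_space prob_space_return)
  have "sets (kendall_unit \<alpha> ?u) = sets borel"
    using measurable_space[OF measurable_kendall_unit[OF assms(1)], of ?u]
    by (simp add: space_prob_algebra)
  note [measurable_cong] = this
  have "(\<integral>\<^sup>+z. g z \<partial>kendall_point \<alpha> x y) = (\<integral>\<^sup>+z. g (?M * z) \<partial>kendall_unit \<alpha> ?u)"
    using assms(4) unfolding kendall_point_def by (simp add: nn_integral_distr)
  also have "\<dots> = (\<integral>\<^sup>+b. (\<integral>\<^sup>+z. g (?M * z) \<partial>(if b then pareto \<alpha> else return borel 1))
      \<partial>measure_pmf (bernoulli_pmf (?u powr \<alpha>)))"
    unfolding kendall_unit_def by (rule nn_integral_bind[OF _ N]) simp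
  also have "\<dots> = ennreal (1 - ?u powr \<alpha>) * g ?M +
      ennreal (?u powr \<alpha>) * (\<integral>\<^sup>+z. g (?M * z) \<partial>pareto \<alpha>)"
    using u1 by (simp add: nn_integral_return ac_simps)
  finally show ?thesis .
qed

text \<open>The integrand of Q. Scaling by \<open>t\<close> bounds it by the indicator of [0, t], so
  it is integrable against every law on the half-line; the indicator minus this function is the
  Williamson kernel (1 - (x/t)^\<alpha>)_+ for nonnegative x.\<close>

definition trunc_power :: "real \<Rightarrow> real \<Rightarrow> real \<Rightarrow> real" where
  "trunc_power \<alpha> t x = (x / t) powr \<alpha> * indicator {0..t} x"

lemma trunc_power_measurable [measurable]: "trunc_power \<alpha> t \<in> borel_measurable borel"
  unfolding trunc_power_def by measurable

lemma trunc_power_nonneg: "0 \<le> trunc_power \<alpha> t x"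
  by (simp add: trunc_power_def)

lemma trunc_power_le_indicator:
  assumes "\<alpha> > 0" "t > 0"
  shows "trunc_power \<alpha> t x \<le> indicator {0..t} x"
proof (cases "x \<in> {0..t}")
  case True
  then have "(x / t) powr \<alpha> \<le> 1"
    using assms by (intro powr_le1) auto
  then show ?thesis
    using True by (simp add: trunc_power_def)
qed (simp add: trunc_power_def)

text \<open>The point convolution is computed in terms of minimum and maximum; symmetric expressions
  carry the result back to \<open>x\<close> and \<open>y\<close>.\<close>

lemma comm_min_max:
  fixes x y :: "'a :: linorder"
  shows "f (min x y) * f (max x y) = (f x :: real) * f y" "f (min x y) + f (max x y) = f x + f y"
  by (auto simp: min_def max_def)

text \<open>Everything depends on the larger argument m. If m > t, both sides vanish; if 0 < m \<le>
  t, the atom and the Pareto part are integrated explicitly; two zero arguments are checked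
  directly.\<close>

lemma nn_integral_kendall_point_trunc:
  assumes "\<alpha> > 0" "t > 0" "x \<ge> 0" "y \<ge> 0"
  defines "p \<equiv> indicator {0..t} :: real \<Rightarrow> real" and "q \<equiv> trunc_power \<alpha> t"
  shows "(\<integral>\<^sup>+z. ennreal (p z) \<partial>kendall_point \<alpha> x y) = ennreal (p x * p y - q x * q y)" (is ?P)
    and "(\<integral>\<^sup>+z. ennreal (q z) \<partial>kendall_point \<alpha> x y) =
      ennreal (q x * p y + p x * q y - 2 * (q x * q y))" (is ?Q)
proof -
  have [measurable]: "p \<in> borel_measurable borel" "q \<in> borel_measurable borel"
    unfolding p_def q_def by measurable
  define m where "m = max x y"
  define u where "u = (min x y / m) powr \<alpha>"
  have m_pos: "m > 0 \<or> x = 0 \<and> y = 0"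
    using assms(3,4) by (auto simp: m_def max_def)
  consider "x = 0" "y = 0" | "m > t" | "m > 0" "m \<le> t"
    using assms(3,4) m_pos by fastforce
  then have "?P \<and> ?Q"
  proof cases
    case 1
    then show ?thesis
      using assms(1,2) by (simp add: kendall_point_def nn_integral_return p_def q_def trunc_power_def)
  next
    \<comment> \<open>The Pareto law lives on [1, \<infinity>), so after scaling by m > t it leaves
      no mass in [0, t]; nor does the atom at m.\<close>
    case 2
    have "(\<integral>\<^sup>+z. ennreal (g (m * z)) \<partial>pareto \<alpha>) = 0" if "g \<in> {p, q}" for g
    proof -
      have "(\<integral>\<^sup>+z. ennreal (g (m * z)) \<partial>pareto \<alpha>) = (\<integral>\<^sup>+z. 0 \<partial>pareto \<alpha>)"
      proof (rule nn_integral_cong_AE)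
        show "AE z in pareto \<alpha>. ennreal (g (m * z)) = 0"
          using AE_pareto_ge_1
        proof eventually_elim
          case (elim z)
          have "m * 1 \<le> m * z" using elim 2 assms(2) by (intro mult_left_mono) auto
          then have "m * z > t" using 2 by simp
          then show ?case using that by (auto simp: p_def q_def trunc_power_def)
        qed
      qed
      then show ?thesis by simp
    qed
    moreover have "p m = 0" "q m = 0" "p x = 0 \<and> q x = 0 \<or> p y = 0 \<and> q y = 0"
      using 2 by (auto simp: p_def q_def trunc_power_def m_def max_def indicator_def split: if_splits)
    ultimately show ?thesis
      using 2 assms(1-4)
      by (auto simp add: nn_integral_kendall_point m_def[symmetric])
  next
    case 3
    \<comment> \<open>Since w = \<open>q m\<close> and u w = \<open>q (min x y)\<close>, all
      integrals below become polynomials in u and w.\<close>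
    define w where "w = (m / t) powr \<alpha>"
    have w: "0 \<le> w" "w \<le> 1" "w = q m"
      using 3 assms(1,2) by (auto simp: w_def q_def trunc_power_def intro!: powr_le1)
    have u: "0 \<le> u" "u \<le> 1"
      using 3 assms(1,3,4) by (auto simp: u_def m_def divide_simps intro!: powr_le1)
    have le: "x \<le> t" "y \<le> t" using 3 by (auto simp: m_def)
    have uw: "u * w = q (min x y)"
      using 3 assms(1-4) le by (auto simp: u_def w_def q_def trunc_power_def simp flip: powr_mult)
    have qq: "u * w * w = q x * q y" "u * w + w = q x + q y"
      using comm_min_max[of q x y] by (simp_all add: uw m_def[symmetric] flip: w(3))
    have c: "1 \<le> t / m" using 3 by simp
    \<comment> \<open>The upper limit t/m of the Pareto integrals enters only through these two
      powers, for \<beta> = \<alpha> and \<beta> = 0.\<close>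
    have wi: "(t / m) powr - \<alpha> = w" "(t / m) powr - (2 * \<alpha>) = w * w"
      using 3 assms(2) unfolding w_def
      by (simp_all add: powr_minus powr_divide field_simps flip: powr_add)
    have pareto_p: "(\<integral>\<^sup>+z. ennreal (p (m * z)) \<partial>pareto \<alpha>) = ennreal (1 - w * w)"
    proof -
      have "(\<integral>\<^sup>+z. ennreal (p (m * z)) \<partial>pareto \<alpha>) =
        (\<integral>\<^sup>+z. ennreal (z powr 0) * indicator {1..t / m} z \<partial>pareto \<alpha>)"
      proof (rule nn_integral_cong_AE)
        show "AE z in pareto \<alpha>. ennreal (p (m * z)) = ennreal (z powr 0) * indicator {1..t / m} z"
          using AE_pareto_ge_1
          by eventually_elim (use 3 assms(2) in \<open>auto simp: p_def indicator_def field_simps\<close>)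
      qed
      also have "\<dots> = ennreal (1 - w * w)"
        using assms(1) c by (subst nn_integral_pareto_Icc) (simp_all add: wi)
      finally show ?thesis .
    qed
    have pareto_q: "(\<integral>\<^sup>+z. ennreal (q (m * z)) \<partial>pareto \<alpha>) = ennreal (2 * w * (1 - w))"
    proof -
      have "(\<integral>\<^sup>+z. ennreal (q (m * z)) \<partial>pareto \<alpha>) =
        (\<integral>\<^sup>+z. ennreal w * (ennreal (z powr \<alpha>) * indicator {1..t / m} z) \<partial>pareto \<alpha>)"
      proof (rule nn_integral_cong_AE)
        show "AE z in pareto \<alpha>. ennreal (q (m * z)) = ennreal w * (ennreal (z powr \<alpha>) * indicator {1..t / m} z)"
          using AE_pareto_ge_1
        proof eventually_elim
          case (elim z)
          have "m * z / t = m / t * z" by simp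
          then have "(m * z / t) powr \<alpha> = w * z powr \<alpha>"
            using 3 assms(2) elim by (simp only: w_def powr_mult)
          moreover have "m * z \<in> {0..t} \<longleftrightarrow> z \<in> {1..t / m}"
            using 3 elim by (auto simp: field_simps)
          ultimately show ?case
            using w by (simp add: q_def trunc_power_def indicator_def flip: ennreal_mult)
        qed
      qed
      also have "\<dots> = ennreal w * ennreal (2 * (1 - w))"
        using assms(1) c wi by (subst nn_integral_cmult, simp, subst nn_integral_pareto_Icc) simp_all
      also have "\<dots> = ennreal (2 * w * (1 - w))"
        using w by (simp add: ac_simps flip: ennreal_mult)
      finally show ?thesis .
    qed
    have px: "p x = 1" "p y = 1" "p m = 1"
      using le 3 assms(3,4) by (auto simp: p_def)
    have "w * w \<le> 1" using w by (simp add: mult_le_one)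
    then have "(\<integral>\<^sup>+z. ennreal (p z) \<partial>kendall_point \<alpha> x y) = ennreal ((1 - u) * 1 + u * (1 - w * w))"
      using assms(1,3,4) 3 w u
      by (subst nn_integral_kendall_point)
        (auto simp flip: m_def u_def ennreal_mult ennreal_plus simp: pareto_p px)
    moreover have "(\<integral>\<^sup>+z. ennreal (q z) \<partial>kendall_point \<alpha> x y) =
        ennreal ((1 - u) * w + u * (2 * w * (1 - w)))"
      using assms(1,3,4) 3 w u
      by (subst nn_integral_kendall_point)
        (auto simp flip: m_def u_def ennreal_mult ennreal_plus simp: pareto_q)
    \<comment> \<open>The left-hand sides expand to 1 - u w^2 and w + u w - 2 u w^2, where u w^2 and
      w + u w are the product and the sum of \<open>q x\<close> and \<open>q y\<close>.\<close>
    moreover have "(1 - u) * 1 + u * (1 - w * w) = 1 - q x * q y"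
      "(1 - u) * w + u * (2 * w * (1 - w)) = q x + q y - 2 * (q x * q y)"
      unfolding qq[symmetric] by (simp_all add: algebra_simps)
    ultimately show ?thesis by (simp only: px mult_1_left mult_1_right simp_thms)
  qed
  then show ?P ?Q by auto
qed

section \<open>From point masses to arbitrary laws and their convolution powers\<close>

lemma prob_nonnegD:
  assumes "\<mu> \<in> prob_nonneg"
  shows "\<mu> \<in> space (prob_algebra borel)" "sets \<mu> = sets borel" "prob_space \<mu>" "AE x in \<mu>. 0 \<le> x"
proof -
  show "\<mu> \<in> space (prob_algebra borel)" "sets \<mu> = sets borel" "prob_space \<mu>"
    using assms by (auto simp: prob_nonneg_def space_prob_algebra)
  show "AE x in \<mu>. 0 \<le> x"
    by (rule AE_I[of _ _ "{..<0}"]) (use assms in \<open>auto simp: prob_nonneg_def\<close>)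
qed

lemma nn_integral_kendall_conv:
  assumes "\<alpha> > 0" "\<mu> \<in> space (prob_algebra borel)" "\<kappa> \<in> space (prob_algebra borel)"
    and g: "g \<in> borel_measurable borel"
  shows "(\<integral>\<^sup>+z. g z \<partial>kendall_conv \<alpha> \<mu> \<kappa>) = (\<integral>\<^sup>+x. \<integral>\<^sup>+y. \<integral>\<^sup>+z. g z \<partial>kendall_point \<alpha> x y \<partial>\<kappa> \<partial>\<mu>)"
proof -
  have sets [measurable_cong]: "sets \<mu> = sets borel" "sets \<kappa> = sets borel"
    using assms(2,3) by (auto simp: space_prob_algebra)
  have inner: "(\<lambda>x. \<kappa> \<bind> (\<lambda>y. kendall_point \<alpha> x y)) \<in> \<mu> \<rightarrow>\<^sub>M subprob_algebra borel"
    by (rule measurable_prob_algebraD, rule measurable_bind_prob_space2[where N = borel])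
       (use assms(3) measurable_kendall_point[OF assms(1)] in \<open>auto simp: sets cong: measurable_cong_sets\<close>)
  have point: "kendall_point \<alpha> x \<in> \<kappa> \<rightarrow>\<^sub>M subprob_algebra borel" for x
    using measurable_prob_algebraD[OF measurable_compose[OF measurable_Pair1' measurable_kendall_point[OF assms(1)], of x]]
    by (simp add: sets cong: measurable_cong_sets)
  show ?thesis
    unfolding kendall_conv_def nn_integral_bind[OF g inner] nn_integral_bind[OF g point] ..
qed

text \<open>A sum of two products integrates factor by factor, first in y and then in x. The form
  with four functions covers both the P- and the Q-identity; nonnegativity of the whole sum is
  assumed because \<open>b\<close> may be negative and \<open>ennreal\<close> would cut negative
  values off.\<close>

lemma nn_integral_kendall_conv_bilinear:
  assumes "\<alpha> > 0" "\<mu> \<in> prob_nonneg" "\<kappa> \<in> prob_nonneg" "g \<in> borel_measurable borel"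
    and eq: "\<And>x y. x \<ge> 0 \<Longrightarrow> y \<ge> 0 \<Longrightarrow>
      (\<integral>\<^sup>+z. g z \<partial>kendall_point \<alpha> x y) = ennreal (a x * p y + b x * q y)"
    and nonneg: "\<And>x y. x \<ge> 0 \<Longrightarrow> y \<ge> 0 \<Longrightarrow> 0 \<le> a x * p y + b x * q y"
    and int: "integrable \<mu> a" "integrable \<mu> b" "integrable \<kappa> p" "integrable \<kappa> q"
  shows "(\<integral>\<^sup>+z. g z \<partial>kendall_conv \<alpha> \<mu> \<kappa>) =
    ennreal ((\<integral>x. a x \<partial>\<mu>) * (\<integral>y. p y \<partial>\<kappa>) + (\<integral>x. b x \<partial>\<mu>) * (\<integral>y. q y \<partial>\<kappa>))"
proof -
  note \<mu> = prob_nonnegD[OF assms(2)] and \<kappa> = prob_nonnegD[OF assms(3)]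
  let ?i = "\<lambda>x. a x * (\<integral>y. p y \<partial>\<kappa>) + b x * (\<integral>y. q y \<partial>\<kappa>)"
  have i: "(\<integral>y. a x * p y + b x * q y \<partial>\<kappa>) = ?i x" for x
    using int by simp
  have "(\<integral>\<^sup>+z. g z \<partial>kendall_conv \<alpha> \<mu> \<kappa>) =
      (\<integral>\<^sup>+x. \<integral>\<^sup>+y. \<integral>\<^sup>+z. g z \<partial>kendall_point \<alpha> x y \<partial>\<kappa> \<partial>\<mu>)"
    by (rule nn_integral_kendall_conv) (use assms \<mu> \<kappa> in auto)
  also have "\<dots> = (\<integral>\<^sup>+x. ennreal (?i x) \<partial>\<mu>)"
  proof (rule nn_integral_cong_AE)
    show "AE x in \<mu>. (\<integral>\<^sup>+y. \<integral>\<^sup>+z. g z \<partial>kendall_point \<alpha> x y \<partial>\<kappa>) = ennreal (?i x)"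
      using \<mu>(4)
    proof eventually_elim
      case (elim x)
      have "(\<integral>\<^sup>+y. \<integral>\<^sup>+z. g z \<partial>kendall_point \<alpha> x y \<partial>\<kappa>) = (\<integral>\<^sup>+y. ennreal (a x * p y + b x * q y) \<partial>\<kappa>)"
        by (rule nn_integral_cong_AE) (use \<kappa>(4) in eventually_elim, use elim eq in simp)
      also have "\<dots> = ennreal (\<integral>y. a x * p y + b x * q y \<partial>\<kappa>)"
        by (rule nn_integral_eq_integral)
          (use int in simp, use \<kappa>(4) in eventually_elim, use elim nonneg in simp)
      finally show ?case by (simp add: i)
    qed
  qed
  also have "\<dots> = ennreal (\<integral>x. ?i x \<partial>\<mu>)"
  proof (rule nn_integral_eq_integral)
    show "AE x in \<mu>. 0 \<le> ?i x"
      using \<mu>(4)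
    proof eventually_elim
      case (elim x)
      show ?case unfolding i[symmetric]
        by (rule integral_nonneg_AE) (use \<kappa>(4) in eventually_elim, use elim nonneg in simp)
    qed
  qed (use int in simp)
  also have "(\<integral>x. ?i x \<partial>\<mu>) = (\<integral>x. a x \<partial>\<mu>) * (\<integral>y. p y \<partial>\<kappa>) + (\<integral>x. b x \<partial>\<mu>) * (\<integral>y. q y \<partial>\<kappa>)"
    using int by simp
  finally show ?thesis .
qed

text \<open>For nonnegative arguments the atom sits at the maximum and the Pareto part beyond it, so
  negative numbers carry no mass. This closure makes the pointwise identities, valid for nonnegative
  arguments, applicable to all convolution powers.\<close>

lemma prob_nonneg_kendall_conv:
  assumes "\<alpha> > 0" "\<mu> \<in> prob_nonneg" "\<kappa> \<in> prob_nonneg"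
  shows "kendall_conv \<alpha> \<mu> \<kappa> \<in> prob_nonneg"
proof -
  note \<mu> = prob_nonnegD[OF assms(2)] and \<kappa> = prob_nonnegD[OF assms(3)]
  note conv = kendall_conv_prob_algebra[OF assms(1) \<mu>(1) \<kappa>(1)]
  have pt: "emeasure (kendall_point \<alpha> x y) {..<0} = 0" if "x \<ge> 0" "y \<ge> 0" for x y
  proof (cases "max x y = 0")
    case True
    then show ?thesis by (simp add: kendall_point_def)
  next
    case False
    then have m: "max x y > 0" using that by (auto simp: max_def split: if_splits)
    have sets: "sets (kendall_point \<alpha> x y) = sets borel"
      using measurable_space[OF measurable_kendall_point[OF assms(1)], of "(x, y)"]
      by (simp add: space_prob_algebra space_pair_measure)
    have "emeasure (kendall_point \<alpha> x y) {..<0} = (\<integral>\<^sup>+z. indicator {..<0} z \<partial>kendall_point \<alpha> x y)"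
      using sets by simp
    also have "\<dots> = ennreal ((min x y / max x y) powr \<alpha>) * (\<integral>\<^sup>+z. indicator {..<0} (max x y * z) \<partial>pareto \<alpha>)"
      using nn_integral_kendall_point[OF assms(1) that m, of "indicator {..<0}"] m that by simp
    also have "(\<integral>\<^sup>+z. indicator {..<0} (max x y * z) \<partial>pareto \<alpha>) = (\<integral>\<^sup>+z. 0 \<partial>pareto \<alpha>)"
    proof (rule nn_integral_cong_AE)
      show "AE z in pareto \<alpha>. indicator {..<0} (max x y * z) = (0 :: ennreal)"
        using AE_pareto_ge_1
        by eventually_elim (use m in \<open>auto simp: indicator_def mult_less_0_iff\<close>)
    qed
    finally show ?thesis by simp
  qed
  have "emeasure (kendall_conv \<alpha> \<mu> \<kappa>) {..<0} =
      (\<integral>\<^sup>+x. \<integral>\<^sup>+y. emeasure (kendall_point \<alpha> x y) {..<0} \<partial>\<kappa> \<partial>\<mu>)"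
    by (rule conv(2)) simp
  also have "\<dots> = (\<integral>\<^sup>+x. 0 \<partial>\<mu>)"
  proof (rule nn_integral_cong_AE)
    show "AE x in \<mu>. (\<integral>\<^sup>+y. emeasure (kendall_point \<alpha> x y) {..<0} \<partial>\<kappa>) = 0"
      using \<mu>(4)
    proof eventually_elim
      case (elim x)
      have "(\<integral>\<^sup>+y. emeasure (kendall_point \<alpha> x y) {..<0} \<partial>\<kappa>) = (\<integral>\<^sup>+y. 0 \<partial>\<kappa>)"
        by (rule nn_integral_cong_AE) (use \<kappa>(4) in eventually_elim, use elim pt in simp)
      then show ?case by simp
    qed
  qed
  finally show ?thesis
    using conv(1) by (simp add: prob_nonneg_def space_prob_algebra)
qed

lemma prob_nonneg_kendall_power:
  assumes "\<alpha> > 0" "\<nu> \<in> prob_nonneg"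
  shows "kendall_power \<alpha> \<nu> n \<in> prob_nonneg"
proof (induction n)
  case 0
  show ?case by (simp add: prob_nonneg_def prob_space_return)
qed (use assms in \<open>simp add: prob_nonneg_kendall_conv\<close>)

lemma integral_indicator_Icc:
  assumes "\<mu> \<in> prob_nonneg"
  shows "(\<integral>x. indicator {0..t} x \<partial>\<mu>) = measure \<mu> {0..t}"
  using prob_nonnegD(2)[OF assms] sets_eq_imp_space_eq[OF prob_nonnegD(2)[OF assms]] by simp

lemma integrable_trunc:
  assumes "\<alpha> > 0" "t > 0" "\<mu> \<in> prob_nonneg"
  shows "integrable \<mu> (indicator {0..t} :: real \<Rightarrow> real)" "integrable \<mu> (trunc_power \<alpha> t)"
proof -
  interpret prob_space \<mu> using prob_nonnegD[OF assms(3)] by simp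
  have [measurable_cong]: "sets \<mu> = sets borel" using prob_nonnegD[OF assms(3)] by simp
  have "trunc_power \<alpha> t x \<le> 1" for x
    by (rule order_trans[OF trunc_power_le_indicator[OF assms(1,2)]]) (simp add: indicator_le_1)
  then show "integrable \<mu> (indicator {0..t} :: real \<Rightarrow> real)" "integrable \<mu> (trunc_power \<alpha> t)"
    by (auto intro!: integrable_const_bound[where B = 1] AE_I2 simp: trunc_power_nonneg)
qed

text \<open>In the notation P, Q this is 0 \<le> Q \<le> P, hence G = P - Q is nonnegative.\<close>

lemma integral_trunc_power_le:
  assumes "\<alpha> > 0" "t > 0" "\<mu> \<in> prob_nonneg"
  shows "0 \<le> (\<integral>x. trunc_power \<alpha> t x \<partial>\<mu>)" "(\<integral>x. trunc_power \<alpha> t x \<partial>\<mu>) \<le> measure \<mu> {0..t}"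
  unfolding integral_indicator_Icc[OF assms(3), symmetric]
  by (intro integral_mono integral_nonneg_AE AE_I2 integrable_trunc[OF assms] trunc_power_nonneg
      trunc_power_le_indicator[OF assms(1,2)])+

text \<open>The bilinear lemma applied with (a, b) = (p, -q) for P and with (a, b) = (q, p - 2q) for
  Q, where p is the indicator and q the truncated power.\<close>

lemma kendall_conv_trunc:
  assumes "\<alpha> > 0" "t > 0" "\<mu> \<in> prob_nonneg" "\<kappa> \<in> prob_nonneg"
  defines "P \<equiv> \<lambda>\<mu>. measure \<mu> {0..t}" and "Q \<equiv> \<lambda>\<mu>. \<integral>x. trunc_power \<alpha> t x \<partial>\<mu>"
  shows "P (kendall_conv \<alpha> \<mu> \<kappa>) = P \<mu> * P \<kappa> - Q \<mu> * Q \<kappa>"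
    and "Q (kendall_conv \<alpha> \<mu> \<kappa>) = Q \<mu> * P \<kappa> + P \<mu> * Q \<kappa> - 2 * (Q \<mu> * Q \<kappa>)"
proof -
  let ?p = "indicator {0..t} :: real \<Rightarrow> real" and ?q = "trunc_power \<alpha> t"
  have bnd: "?q x \<le> ?p x" "0 \<le> ?q x" "?p x \<le> 1" "0 \<le> ?p x" for x
    using trunc_power_le_indicator[OF assms(1,2)] by (auto simp: trunc_power_nonneg indicator_def)
  note int = integrable_trunc[OF assms(1,2)]
  have nn: "(\<integral>\<^sup>+x. ennreal (?q x) \<partial>\<eta>) = ennreal (Q \<eta>)" "(\<integral>\<^sup>+x. ennreal (?p x) \<partial>\<eta>) = ennreal (P \<eta>)"
    if "\<eta> \<in> prob_nonneg" for \<eta>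
    unfolding Q_def P_def integral_indicator_Icc[OF that, symmetric]
    by (intro nn_integral_eq_integral AE_I2 int[OF that] bnd)+
  have PQ_nonneg: "0 \<le> Q \<eta>" "Q \<eta> \<le> P \<eta>" if "\<eta> \<in> prob_nonneg" for \<eta>
    unfolding P_def Q_def by (rule integral_trunc_power_le[OF assms(1,2) that])+
  note c = prob_nonneg_kendall_conv[OF assms(1,3,4)]
  have PQ: "ennreal (P (kendall_conv \<alpha> \<mu> \<kappa>)) = ennreal ((\<integral>x. ?p x \<partial>\<mu>) * (\<integral>y. ?p y \<partial>\<kappa>) + (\<integral>x. - ?q x \<partial>\<mu>) * (\<integral>y. ?q y \<partial>\<kappa>))"
    unfolding nn(2)[OF c, symmetric]
  proof (rule nn_integral_kendall_conv_bilinear[OF assms(1,3,4)])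
    fix x y :: real
    show "0 \<le> ?p x * ?p y + - ?q x * ?q y"
      using mult_mono[OF bnd(1)[of x] bnd(1)[of y]] bnd by simp
  qed (use assms(1,2) int assms(3,4) in \<open>auto simp: nn_integral_kendall_point_trunc\<close>)
  have QQ: "ennreal (Q (kendall_conv \<alpha> \<mu> \<kappa>)) = ennreal ((\<integral>x. ?q x \<partial>\<mu>) * (\<integral>y. ?p y \<partial>\<kappa>) + (\<integral>x. ?p x - 2 * ?q x \<partial>\<mu>) * (\<integral>y. ?q y \<partial>\<kappa>))"
    unfolding nn(1)[OF c, symmetric]
  proof (rule nn_integral_kendall_conv_bilinear[OF assms(1,3,4)])
    fix x y :: real
    have "?q x * ?q y \<le> ?q x * ?p y" "?q x * ?q y \<le> ?p x * ?q y"
      using bnd by (auto intro: mult_left_mono mult_right_mono)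
    then show "0 \<le> ?q x * ?p y + (?p x - 2 * ?q x) * ?q y"
      by (simp add: algebra_simps)
  qed (use assms(1,2) int assms(3,4) in \<open>auto simp: nn_integral_kendall_point_trunc algebra_simps\<close>)
  \<comment> \<open>These bounds make the right-hand sides nonnegative, so that the equations in
    \<open>ennreal\<close> can be read as equations of reals.\<close>
  have ge: "Q \<mu> * Q \<kappa> \<le> P \<mu> * P \<kappa>" "Q \<mu> * Q \<kappa> \<le> Q \<mu> * P \<kappa>" "Q \<mu> * Q \<kappa> \<le> P \<mu> * Q \<kappa>"
    using PQ_nonneg[OF assms(3)] PQ_nonneg[OF assms(4)] by (auto intro!: mult_mono intro: order_trans)
  have i: "(\<integral>x. - ?q x \<partial>\<mu>) = - Q \<mu>" "(\<integral>x. ?p x - 2 * ?q x \<partial>\<mu>) = P \<mu> - 2 * Q \<mu>"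
      "(\<integral>x. ?p x \<partial>\<mu>) = P \<mu>" "(\<integral>x. ?p x \<partial>\<kappa>) = P \<kappa>" "(\<integral>x. ?q x \<partial>\<mu>) = Q \<mu>" "(\<integral>x. ?q x \<partial>\<kappa>) = Q \<kappa>"
    unfolding P_def Q_def integral_indicator_Icc[OF assms(3), symmetric] integral_indicator_Icc[OF assms(4), symmetric]
    using int[OF assms(3)] by (simp_all del: integral_indicator Bochner_Integration.integral_indicator)
  have "P \<mu> * P \<kappa> + - Q \<mu> * Q \<kappa> \<ge> 0"
    using ge by simp
  then show "P (kendall_conv \<alpha> \<mu> \<kappa>) = P \<mu> * P \<kappa> - Q \<mu> * Q \<kappa>"
    using PQ[unfolded i] PQ_nonneg[OF c] by (subst (asm) ennreal_inj) auto
  have "Q \<mu> * P \<kappa> + (P \<mu> - 2 * Q \<mu>) * Q \<kappa> \<ge> 0"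
    using ge by (simp add: algebra_simps)
  then show "Q (kendall_conv \<alpha> \<mu> \<kappa>) = Q \<mu> * P \<kappa> + P \<mu> * Q \<kappa> - 2 * (Q \<mu> * Q \<kappa>)"
    using QQ[unfolded i] PQ_nonneg(1)[OF c] by (subst (asm) ennreal_inj) (auto simp: algebra_simps)
qed

text \<open>With P = G + Q the rule for Q becomes Q = Q1 G2 + G1 Q2, so the pair (G, Q) multiplies
  like the dual number G + \<epsilon> Q, and the n-th power has \<epsilon>-part n G^(n-1) Q. The
  induction therefore carries P and Q together.\<close>

lemma measure_kendall_power_Icc:
  assumes "\<alpha> > 0" "t > 0" "\<nu> \<in> prob_nonneg"
  defines "Q \<equiv> (\<integral>x. trunc_power \<alpha> t x \<partial>\<nu>)"
  defines "G \<equiv> measure \<nu> {0..t} - Q"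
  shows "measure (kendall_power \<alpha> \<nu> n) {0..t} = G ^ n + of_nat n * G ^ (n - 1) * Q"
proof -
  let ?Q = "\<lambda>n. \<integral>x. trunc_power \<alpha> t x \<partial>kendall_power \<alpha> \<nu> n"
  have "measure (kendall_power \<alpha> \<nu> n) {0..t} = G ^ n + of_nat n * G ^ (n - 1) * Q \<and>
    ?Q n = of_nat n * G ^ (n - 1) * Q"
  proof (induction n)
    case 0
    show ?case using assms(2) by (simp add: measure_return integral_return trunc_power_def)
  next
    case (Suc n)
    have G: "measure \<nu> {0..t} = G + Q" by (simp add: G_def)
    \<comment> \<open>The case n = 0 is split off because \<open>n - 1\<close> is truncated there;
      the factor \<open>of_nat n\<close> makes that term vanish.\<close>
    show ?case
      using Suc kendall_conv_trunc[OF assms(1-3) prob_nonneg_kendall_power[OF assms(1,3), of n]]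
      by (cases n) (simp_all add: Q_def[symmetric] G algebra_simps)
  qed
  then show ?thesis by simp
qed


section \<open>The Kendall random walk and its renewal function\<close>

lemma measurable_nn_integral_kendall_point:
  assumes "\<alpha> > 0" "\<kappa> \<in> space (prob_algebra borel)" "A \<in> sets borel"
  shows "(\<lambda>x. \<integral>\<^sup>+y. emeasure (kendall_point \<alpha> x y) A \<partial>\<kappa>) \<in> borel_measurable borel"
proof -
  interpret prob_space \<kappa> using assms(2) by (simp add: space_prob_algebra)
  have [measurable_cong]: "sets \<kappa> = sets borel" using assms(2) by (simp add: space_prob_algebra)
  have [measurable]: "(\<lambda>z. emeasure (kendall_point \<alpha> (fst z) (snd z)) A) \<in> borel_measurable (borel \<Otimes>\<^sub>M borel)"
    using measurable_compose[OF measurable_prob_algebraD[OF measurable_kendall_point[OF assms(1)]]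
        measurable_emeasure_subprob_algebra[OF assms(3)]]
    by (simp add: case_prod_beta)
  show ?thesis by (rule borel_measurable_nn_integral) (simp add: case_prod_beta)
qed

lemma emeasure_kendall_conv_return:
  assumes "\<alpha> > 0" "\<kappa> \<in> space (prob_algebra borel)" "A \<in> sets borel"
  shows "emeasure (kendall_conv \<alpha> (return borel x) \<kappa>) A = (\<integral>\<^sup>+y. emeasure (kendall_point \<alpha> x y) A \<partial>\<kappa>)"
proof -
  have "return borel x \<in> space (prob_algebra borel)"
    by (simp add: space_prob_algebra prob_space_return)
  then show ?thesis
    using measurable_nn_integral_kendall_point[OF assms]
    by (simp add: kendall_conv_prob_algebra(2)[OF assms(1) _ assms(2,3)] nn_integral_return)
qed

lemma
  fixes \<alpha> x :: real
  assumes "\<alpha> > 0" "\<kappa> \<in> space (prob_algebra borel)"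
  shows emeasure_eq_measure_kendall_conv_return:
      "emeasure (kendall_conv \<alpha> (return borel x) \<kappa>) A =
        ennreal (measure (kendall_conv \<alpha> (return borel x) \<kappa>) A)"
    and measure_kendall_conv_return_le_1: "measure (kendall_conv \<alpha> (return borel x) \<kappa>) A \<le> 1"
proof -
  have "return borel x \<in> space (prob_algebra borel)"
    by (simp add: space_prob_algebra prob_space_return)
  from kendall_conv_prob_algebra(1)[OF assms(1) this assms(2)]
  interpret prob_space "kendall_conv \<alpha> (return borel x) \<kappa>" by (simp add: space_prob_algebra)
  show "emeasure (kendall_conv \<alpha> (return borel x) \<kappa>) A = ennreal (measure (kendall_conv \<alpha> (return borel x) \<kappa>) A)"
    "measure (kendall_conv \<alpha> (return borel x) \<kappa>) A \<le> 1"
    by (simp_all add: emeasure_eq_measure)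
qed

lemma measurable_measure_kendall_conv_return:
  assumes "\<alpha> > 0" "\<kappa> \<in> space (prob_algebra borel)" "A \<in> sets borel"
  shows "(\<lambda>x. measure (kendall_conv \<alpha> (return borel x) \<kappa>) A) \<in> borel_measurable borel"
  unfolding measure_def emeasure_kendall_conv_return[OF assms]
  using measurable_nn_integral_kendall_point[OF assms] by simp

lemma subalgebra_history:
  assumes "\<And>i. 1 \<le> i \<Longrightarrow> S i \<in> borel_measurable M"
  shows "subalgebra M (history M S k)"
proof -
  have "(\<Union>i\<in>{1..k}. {S i -` A \<inter> space M | A. A \<in> sets borel}) \<subseteq> sets M"
    using assms by (auto intro: measurable_sets)
  then have "sigma_sets (space M) (\<Union>i\<in>{1..k}. {S i -` A \<inter> space M | A. A \<in> sets borel}) \<subseteq> sets M"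
    by (rule sets.sigma_sets_subset)
  then show ?thesis
    unfolding subalgebra_def history_def by (subst sets_measure_of) (auto simp: space_measure_of_conv)
qed

lemma vimage_in_sets_history:
  assumes "1 \<le> i" "i \<le> k" "A \<in> sets borel"
  shows "S i -` A \<inter> space M \<in> sets (history M S k)"
proof -
  have "S i -` A \<inter> space M \<in> (\<Union>i\<in>{1..k}. {S i -` A \<inter> space M | A. A \<in> sets borel})"
    using assms by fastforce
  then show ?thesis
    unfolding history_def by (subst sets_measure_of) (auto intro: sigma_sets.Basic)
qed

text \<open>The defining property of conditional expectation, integrated over an event B of the
  history, turns the almost sure Markov property into an equation between measures.\<close>

lemma kendall_random_walk_transition:
  assumes "\<alpha> > 0" "\<nu> \<in> prob_nonneg" "kendall_random_walk \<alpha> \<nu> M S"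
    and "1 \<le> k" "k < n" and A: "A \<in> sets borel" and B: "B \<in> sets (history M S k)"
  shows "emeasure M (S n -` A \<inter> space M \<inter> B) =
    (\<integral>\<^sup>+\<omega>. emeasure (kendall_conv \<alpha> (return borel (S k \<omega>)) (kendall_power \<alpha> \<nu> (n - k))) A * indicator B \<omega> \<partial>M)"
proof -
  have S [measurable]: "S i \<in> borel_measurable M" if "1 \<le> i" for i
    using assms(3) that by (simp add: kendall_random_walk_def)
  interpret prob_space M using assms(3) by (simp add: kendall_random_walk_def)
  interpret H: sigma_finite_subalgebra M "history M S k"
    by (intro finite_measure_subalgebra_is_sigma_finite finite_measure_subalgebra.intro
        finite_measure_axioms finite_measure_subalgebra_axioms.intro subalgebra_history S)
  have n: "1 \<le> n" using assms by simp
  note [measurable] = S[OF n] S[OF assms(4)] A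
  have BM [measurable]: "B \<in> sets M"
    using subalgebra_history[where S = S and k = k, OF S] B unfolding subalgebra_def by auto
  have \<kappa>: "kendall_power \<alpha> \<nu> (n - k) \<in> space (prob_algebra borel)"
    using prob_nonneg_kendall_power[OF assms(1,2)] prob_nonnegD by blast
  let ?m = "\<lambda>\<omega>. measure (kendall_conv \<alpha> (return borel (S k \<omega>)) (kendall_power \<alpha> \<nu> (n - k))) A"
  have [measurable]: "?m \<in> borel_measurable M"
    by (rule measurable_compose[OF S[OF assms(4)] measurable_measure_kendall_conv_return[OF assms(1) \<kappa> A]])
  have intA: "integrable M (\<lambda>\<omega>. indicator A (S n \<omega>) :: real)"
    by (rule integrable_const_bound[where B = 1]) auto
  have "measure M (S n -` A \<inter> space M \<inter> B) = (LINT \<omega>:B|M. indicator A (S n \<omega>))"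
  proof -
    have "(LINT \<omega>:B|M. indicator A (S n \<omega>)) = (LINT \<omega>|M. indicator (S n -` A \<inter> space M \<inter> B) \<omega> :: real)"
      unfolding set_lebesgue_integral_def
      by (rule Bochner_Integration.integral_cong) (auto simp: indicator_def)
    then show ?thesis by simp
  qed
  also have "\<dots> = (LINT \<omega>:B|M. real_cond_exp M (history M S k) (\<lambda>\<omega>. indicator A (S n \<omega>)) \<omega>)"
    by (rule H.real_cond_exp_intA[OF intA B])
  also have "\<dots> = (LINT \<omega>|M. ?m \<omega> * indicator B \<omega>)"
    unfolding set_lebesgue_integral_def
  proof (rule integral_cong_AE)
    have "AE \<omega> in M. real_cond_exp M (history M S k) (\<lambda>\<omega>. indicator A (S n \<omega>)) \<omega> = ?m \<omega>"
      using assms(3-5) A unfolding kendall_random_walk_def by blast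
    then show "AE \<omega> in M. indicator B \<omega> *\<^sub>R real_cond_exp M (history M S k) (\<lambda>\<omega>. indicator A (S n \<omega>)) \<omega> =
        ?m \<omega> * indicator B \<omega>"
      by eventually_elim simp
  qed (use borel_measurable_cond_exp2 in measurable)
  finally have "emeasure M (S n -` A \<inter> space M \<inter> B) = ennreal (LINT \<omega>|M. ?m \<omega> * indicator B \<omega>)"
    by (simp add: emeasure_eq_measure)
  also have "\<dots> = (\<integral>\<^sup>+\<omega>. ennreal (?m \<omega> * indicator B \<omega>) \<partial>M)"
  proof (rule nn_integral_eq_integral[symmetric])
    show "integrable M (\<lambda>\<omega>. ?m \<omega> * indicator B \<omega>)"
      using measure_kendall_conv_return_le_1[OF assms(1) \<kappa>]
      by (intro integrable_const_bound[where B = 1]) (auto intro!: AE_I2 mult_le_one)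
  qed simp
  also have "\<dots> = (\<integral>\<^sup>+\<omega>. emeasure (kendall_conv \<alpha> (return borel (S k \<omega>)) (kendall_power \<alpha> \<nu> (n - k))) A * indicator B \<omega> \<partial>M)"
    unfolding emeasure_eq_measure_kendall_conv_return[OF assms(1) \<kappa>]
    by (rule nn_integral_cong) (simp add: indicator_def)
  finally show ?thesis .
qed

text \<open>Conditioning on the first step, whose law is \<nu>, reproduces the recursion of the
  convolution power, which convolves with \<nu> on the left. The transition law needs n \<ge> 1, so
  S 1 is treated separately through \<open>kendall_power_one\<close>.\<close>

lemma emeasure_kendall_random_walk:
  assumes "\<alpha> > 0" "\<nu> \<in> prob_nonneg" "kendall_random_walk \<alpha> \<nu> M S"
    and A: "A \<in> sets borel"
  shows "emeasure M (S (Suc n) -` A \<inter> space M) = emeasure (kendall_power \<alpha> \<nu> (Suc n)) A"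
proof -
  have S1: "S 1 \<in> borel_measurable M" "distr M borel (S 1) = \<nu>"
    using assms(3) by (auto simp add: kendall_random_walk_def)
  show ?thesis
  proof (cases "n = 0")
    case True
    then show ?thesis
      using S1(2) kendall_power_one[OF assms(1,2)] emeasure_distr[OF S1(1) A] by simp
  next
    case False
    have \<kappa>: "kendall_power \<alpha> \<nu> n \<in> space (prob_algebra borel)"
      using prob_nonneg_kendall_power[OF assms(1,2)] prob_nonnegD by blast
    have "space M = space (history M S 1)"
      by (simp add: history_def space_measure_of_conv)
    then have "space M \<in> sets (history M S 1)"
      by simp
    then have "emeasure M (S (Suc n) -` A \<inter> space M) =
      (\<integral>\<^sup>+\<omega>. emeasure (kendall_conv \<alpha> (return borel (S 1 \<omega>)) (kendall_power \<alpha> \<nu> n)) A * indicator (space M) \<omega> \<partial>M)"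
      using kendall_random_walk_transition[OF assms(1-3) _ _ A, of 1 "Suc n" "space M"] False
      by (simp add: Int_absorb2 Int_assoc)
    also have "\<dots> = (\<integral>\<^sup>+\<omega>. \<integral>\<^sup>+y. emeasure (kendall_point \<alpha> (S 1 \<omega>) y) A \<partial>kendall_power \<alpha> \<nu> n \<partial>M)"
      by (rule nn_integral_cong) (simp add: emeasure_kendall_conv_return[OF assms(1) \<kappa> A])
    also have "\<dots> = (\<integral>\<^sup>+x. \<integral>\<^sup>+y. emeasure (kendall_point \<alpha> x y) A \<partial>kendall_power \<alpha> \<nu> n \<partial>distr M borel (S 1))"
      by (rule nn_integral_distr[OF S1(1), symmetric])
        (use measurable_nn_integral_kendall_point[OF assms(1) \<kappa> A] in simp)
    also have "\<dots> = emeasure (kendall_power \<alpha> \<nu> (Suc n)) A"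
      using prob_nonnegD(1)[OF assms(2)] by (simp add: S1(2) kendall_conv_prob_algebra(2)[OF assms(1) _ \<kappa> A] del: One_nat_def)
    finally show ?thesis .
  qed
qed

text \<open>The point convolution is carried by [max x y, \<infinity>), hence by numbers greater
  than t.\<close>

lemma emeasure_kendall_point_atMost:
  assumes "\<alpha> > 0" "x \<ge> 0" "y \<ge> 0" "t < x"
  shows "emeasure (kendall_point \<alpha> x y) {..t} = 0"
proof -
  have m: "max x y > t" "0 \<le> max x y" using assms by auto
  show ?thesis
  proof (cases "max x y = 0")
    case True
    then show ?thesis using m by (simp add: kendall_point_def)
  next
    case False
    then have m0: "max x y > 0" using m by simp
    have ind: "(indicator {..t} (max x y) :: ennreal) = 0"
      using m(1) by (auto simp: indicator_def)
    have "sets (kendall_point \<alpha> x y) = sets borel"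
      using measurable_space[OF measurable_kendall_point[OF assms(1)], of "(x, y)"]
      by (simp add: space_prob_algebra space_pair_measure)
    then have "emeasure (kendall_point \<alpha> x y) {..t} = (\<integral>\<^sup>+z. indicator {..t} z \<partial>kendall_point \<alpha> x y)"
      by simp
    also have "\<dots> = ennreal ((min x y / max x y) powr \<alpha>) * (\<integral>\<^sup>+z. indicator {..t} (max x y * z) \<partial>pareto \<alpha>)"
      using nn_integral_kendall_point[OF assms(1-3) m0, of "indicator {..t}"] ind by simp
    also have "(\<integral>\<^sup>+z. indicator {..t} (max x y * z) \<partial>pareto \<alpha>) = (\<integral>\<^sup>+z. 0 \<partial>pareto \<alpha>)"
    proof (rule nn_integral_cong_AE)
      show "AE z in pareto \<alpha>. indicator {..t} (max x y * z) = (0 :: ennreal)"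
        using AE_pareto_ge_1
      proof eventually_elim
        case (elim z)
        have "max x y * 1 \<le> max x y * z"
          using elim m by (intro mult_left_mono) auto
        with m(1) have "max x y * z \<notin> {..t}"
          unfolding mult_1_right atMost_iff not_le by (rule less_le_trans)
        then show ?case by (rule indicator_simps(2))
      qed
    qed
    finally show ?thesis by simp
  qed
qed

text \<open>One transition from a state above t stays above t almost surely. Monotonicity is stated
  at a fixed level t, which is the form in which N(t) uses it.\<close>

lemma AE_kendall_random_walk_mono:
  assumes "\<alpha> > 0" "\<nu> \<in> prob_nonneg" "kendall_random_walk \<alpha> \<nu> M S" "t > 0"
  shows "AE \<omega> in M. S (Suc (Suc n)) \<omega> \<le> t \<longrightarrow> S (Suc n) \<omega> \<le> t"
proof -
  have [measurable]: "S (Suc i) \<in> borel_measurable M" for i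
    using assms(3) by (simp add: kendall_random_walk_def)
  have \<kappa>: "kendall_power \<alpha> \<nu> 1 \<in> space (prob_algebra borel)"
    using prob_nonneg_kendall_power[OF assms(1,2)] prob_nonnegD by blast
  \<comment> \<open>The event of being above t belongs to the history, so the transition formula can
    be restricted to it.\<close>
  let ?B = "S (Suc n) -` {t<..} \<inter> space M"
  have "emeasure M (S (Suc (Suc n)) -` {..t} \<inter> space M \<inter> ?B) =
    (\<integral>\<^sup>+\<omega>. emeasure (kendall_conv \<alpha> (return borel (S (Suc n) \<omega>)) (kendall_power \<alpha> \<nu> 1)) {..t} * indicator ?B \<omega> \<partial>M)"
    using kendall_random_walk_transition[OF assms(1-3), of "Suc n" "Suc (Suc n)" "{..t}" ?B]
    by (simp add: vimage_in_sets_history)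
  also have "\<dots> = (\<integral>\<^sup>+\<omega>. 0 \<partial>M)"
  proof (rule nn_integral_cong)
    fix \<omega> assume "\<omega> \<in> space M"
    have "emeasure (kendall_conv \<alpha> (return borel (S (Suc n) \<omega>)) (kendall_power \<alpha> \<nu> 1)) {..t} = 0" if "S (Suc n) \<omega> > t"
    proof -
      have "emeasure (kendall_conv \<alpha> (return borel (S (Suc n) \<omega>)) (kendall_power \<alpha> \<nu> 1)) {..t} =
          (\<integral>\<^sup>+y. emeasure (kendall_point \<alpha> (S (Suc n) \<omega>) y) {..t} \<partial>kendall_power \<alpha> \<nu> 1)"
        by (rule emeasure_kendall_conv_return[OF assms(1) \<kappa>]) simp
      also have "\<dots> = (\<integral>\<^sup>+y. 0 \<partial>kendall_power \<alpha> \<nu> 1)"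
        by (rule nn_integral_cong_AE)
          (use prob_nonnegD(4)[OF prob_nonneg_kendall_power[OF assms(1,2), of 1]] in eventually_elim,
           use that assms(1,4) in \<open>simp add: emeasure_kendall_point_atMost\<close>)
      finally show ?thesis by simp
    qed
    then show "emeasure (kendall_conv \<alpha> (return borel (S (Suc n) \<omega>)) (kendall_power \<alpha> \<nu> 1)) {..t} * indicator ?B \<omega> = 0"
      by (simp add: indicator_def)
  qed
  finally have "emeasure M (S (Suc (Suc n)) -` {..t} \<inter> space M \<inter> ?B) = 0" by simp
  then show ?thesis
    by (intro AE_I[of _ _ "S (Suc (Suc n)) -` {..t} \<inter> space M \<inter> ?B"]) auto
qed

section \<open>The renewal process and its expectation\<close>

lemma less_renewal_process_iff: "enat n < renewal_process S t \<omega> \<longleftrightarrow> (\<forall>i\<le>n. S (Suc i) \<omega> \<le> t)"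
proof
  assume "enat n < renewal_process S t \<omega>"
  show "\<forall>i\<le>n. S (Suc i) \<omega> \<le> t"
  proof (intro allI impI, rule ccontr)
    fix i assume "i \<le> n" "\<not> S (Suc i) \<omega> \<le> t"
    then have "renewal_process S t \<omega> \<le> enat i"
      unfolding renewal_process_def by (intro INF_lower) auto
    also have "\<dots> \<le> enat n" using \<open>i \<le> n\<close> by simp
    finally show False using \<open>enat n < renewal_process S t \<omega>\<close> by simp
  qed
next
  assume *: "\<forall>i\<le>n. S (Suc i) \<omega> \<le> t"
  have "enat (Suc n) \<le> renewal_process S t \<omega>"
    unfolding renewal_process_def
  proof (rule INF_greatest)
    fix i assume "i \<in> {n. t < S (Suc n) \<omega>}"
    then have "\<not> i \<le> n" using * by force
    then show "enat (Suc n) \<le> enat i" by simp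
  qed
  then show "enat n < renewal_process S t \<omega>"
    by (rule less_le_trans[rotated]) simp
qed

text \<open>The index set of the infimum depends on the path; giving the excluded indices the value
  \<infinity> turns it into a countable infimum of measurable functions.\<close>

lemma measurable_renewal_process:
  assumes "\<And>i. S (Suc i) \<in> borel_measurable M"
  shows "renewal_process S t \<in> measurable M (count_space UNIV)"
proof -
  have "renewal_process S t = (\<lambda>\<omega>. INF n. if t < S (Suc n) \<omega> then enat n else \<infinity>)"
    unfolding renewal_process_def
  proof (intro ext antisym INF_greatest)
    fix \<omega> i assume "i \<in> {n. t < S (Suc n) \<omega>}"
    then show "(INF n. if t < S (Suc n) \<omega> then enat n else \<infinity>) \<le> enat i"
      by (intro INF_lower2[of i]) auto
  qed (auto intro: INF_lower)
  also have "\<dots> \<in> measurable M (count_space UNIV)"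
    using assms by measurable
  finally show ?thesis .
qed

text \<open>The expectation of N(t) is the sum of the probabilities of N(t) > n. By almost sure
  monotonicity the condition on S_1, ..., S_(n+1) reduces to S_(n+1) \<le> t, which explains the
  power \<open>Suc n\<close>.\<close>

lemma renewal_function_eq_suminf:
  assumes "\<alpha> > 0" "\<nu> \<in> prob_nonneg" "kendall_random_walk \<alpha> \<nu> M S" "t > 0"
  shows "renewal_function M S t = (\<Sum>n. ennreal (measure (kendall_power \<alpha> \<nu> (Suc n)) {0..t}))"
proof -
  have [measurable]: "S (Suc i) \<in> borel_measurable M" for i
    using assms(3) by (simp add: kendall_random_walk_def)
  note [measurable] = measurable_renewal_process[of S, OF this]
  have mono: "AE \<omega> in M. \<forall>n. S (Suc (Suc n)) \<omega> \<le> t \<longrightarrow> S (Suc n) \<omega> \<le> t"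
    using AE_kendall_random_walk_mono[OF assms] by (simp add: AE_all_countable)
  have "emeasure M {\<omega> \<in> space M. enat n < renewal_process S t \<omega>} =
      ennreal (measure (kendall_power \<alpha> \<nu> (Suc n)) {0..t})" for n
  proof -
    have "emeasure M {\<omega> \<in> space M. enat n < renewal_process S t \<omega>} = emeasure M (S (Suc n) -` {..t} \<inter> space M)"
    proof (rule emeasure_eq_AE)
      show "AE \<omega> in M. \<omega> \<in> {\<omega> \<in> space M. enat n < renewal_process S t \<omega>} \<longleftrightarrow> \<omega> \<in> S (Suc n) -` {..t} \<inter> space M"
        using mono
      proof eventually_elim
        case (elim \<omega>)
        \<comment> \<open>Descending induction: \<open>n - j\<close> runs from n down to 0, so the
          bound at the last index passes to all earlier ones.\<close>
        have "S (Suc (n - j)) \<omega> \<le> t" if "S (Suc n) \<omega> \<le> t" for j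
        proof (induction j)
          case (Suc j)
          then show ?case
            using elim by (cases "n - j") (auto simp: diff_Suc)
        qed (use that in simp)
        then have "(\<forall>i\<le>n. S (Suc i) \<omega> \<le> t) \<longleftrightarrow> S (Suc n) \<omega> \<le> t"
          by (metis diff_diff_cancel le_refl)
        then show ?case by (auto simp: less_renewal_process_iff)
      qed
    qed measurable
    also have "\<dots> = emeasure (kendall_power \<alpha> \<nu> (Suc n)) {..t}"
      by (rule emeasure_kendall_random_walk[OF assms(1-3)]) simp
    also have "\<dots> = emeasure (kendall_power \<alpha> \<nu> (Suc n)) {0..t}"
    proof (rule emeasure_eq_AE)
      note p = prob_nonnegD[OF prob_nonneg_kendall_power[OF assms(1,2), of "Suc n"]]
      show "AE x in kendall_power \<alpha> \<nu> (Suc n). x \<in> {..t} \<longleftrightarrow> x \<in> {0..t}"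
        using p(4) by eventually_elim auto
      show "{..t} \<in> sets (kendall_power \<alpha> \<nu> (Suc n))" "{0..t} \<in> sets (kendall_power \<alpha> \<nu> (Suc n))"
        unfolding p(2) by auto
    qed
    also have "\<dots> = ennreal (measure (kendall_power \<alpha> \<nu> (Suc n)) {0..t})"
    proof -
      interpret p: prob_space "kendall_power \<alpha> \<nu> (Suc n)"
        by (rule prob_nonnegD[OF prob_nonneg_kendall_power[OF assms(1,2)]])
      show ?thesis by (rule p.emeasure_eq_measure)
    qed
    finally show ?thesis .
  qed
  then show ?thesis
    unfolding renewal_function_def by (simp add: nn_integral_enat_function del: kendall_power.simps)
qed

text \<open>The two terms of the mass formula sum to a geometric series and to its derivative; both
  converge because 0 \<le> G < 1.\<close>

lemma renewal_function_closed_form: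
  assumes "\<alpha> > 0" "\<nu> \<in> prob_nonneg" "kendall_random_walk \<alpha> \<nu> M S" "t > 0"
  defines "Q \<equiv> (\<integral>x. trunc_power \<alpha> t x \<partial>\<nu>)"
  defines "G \<equiv> measure \<nu> {0..t} - Q"
  assumes "G < 1"
  shows "renewal_function M S t = ennreal (G / (1 - G) + Q / (1 - G)\<^sup>2)"
proof -
  have Q: "0 \<le> Q" "0 \<le> G"
    using integral_trunc_power_le[OF assms(1,4,2)] by (auto simp: Q_def G_def)
  have "(\<lambda>n. G * G ^ n + Q * (of_nat (Suc n) * G ^ n)) sums (G * (1 / (1 - G)) + Q * (1 / (1 - G)\<^sup>2))"
    using assms(7) Q by (intro sums_add sums_mult geometric_sums geometric_deriv_sums) auto
  then have "(\<lambda>n. G ^ Suc n + of_nat (Suc n) * G ^ (Suc n - 1) * Q) sums (G / (1 - G) + Q / (1 - G)\<^sup>2)"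
    by (simp add: mult_ac)
  then have "(\<Sum>n. ennreal (G ^ Suc n + of_nat (Suc n) * G ^ (Suc n - 1) * Q)) = ennreal (G / (1 - G) + Q / (1 - G)\<^sup>2)"
    using Q by (intro suminf_ennreal_eq) auto
  then show ?thesis
    unfolding renewal_function_eq_suminf[OF assms(1-4)]
    by (simp only: measure_kendall_power_Icc[OF assms(1,4,2)] Q_def G_def)
qed


section \<open>Asymptotics\<close>

text \<open>By the mean value theorem the increment is h times the derivative at some point beyond
  t, and that derivative is close to L for large t.\<close>

lemma tendsto_diff_shift_of_deriv:
  fixes B B' :: "real \<Rightarrow> real"
  assumes deriv: "\<forall>\<^sub>F t in at_top. (B has_real_derivative B' t) (at t)"
    and lim: "(B' \<longlongrightarrow> L) at_top" and "h > 0"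
  shows "((\<lambda>t. B (t + h) - B t) \<longlongrightarrow> h * L) at_top"
proof (rule tendstoI)
  fix e :: real assume "e > 0"
  then have "\<forall>\<^sub>F t in at_top. dist (B' t) L < e / h"
    using assms(3) by (intro tendstoD[OF lim]) simp
  with deriv have "\<forall>\<^sub>F t in at_top. (B has_real_derivative B' t) (at t) \<and> dist (B' t) L < e / h"
    by (rule eventually_conj)
  then obtain T where T: "\<And>t. t \<ge> T \<Longrightarrow> (B has_real_derivative B' t) (at t)"
      "\<And>t. t \<ge> T \<Longrightarrow> dist (B' t) L < e / h"
    unfolding eventually_at_top_linorder by blast
  show "\<forall>\<^sub>F t in at_top. dist (B (t + h) - B t) (h * L) < e"
    using eventually_ge_at_top[of T]
  proof eventually_elim
    case (elim t)
    obtain z where z: "t < z" "z < t + h" "B (t + h) - B t = (t + h - t) * B' z"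
      using MVT2[of t "t + h" B B'] T(1) elim assms(3) by auto
    have "\<bar>h * B' z - h * L\<bar> = h * dist (B' z) L"
      using assms(3) by (simp add: dist_real_def abs_mult flip: right_diff_distrib)
    also have "\<dots> < h * (e / h)"
      using assms(3) T(2)[of z] z elim by (intro mult_strict_left_mono) auto
    finally show ?case using assms(3) z(3) by (simp add: dist_real_def)
  qed
qed

text \<open>Applied with \<open>g t = t powr \<alpha>\<close>: it differentiates \<open>H\<close> at every point although the density need
  not be continuous.\<close>

lemma has_real_derivative_of_weighted_increments:
  fixes F H g :: "real \<Rightarrow> real"
  assumes F: "(F has_real_derivative D) (at t)" and g: "isCont g t" and "a < t"
    and lo: "\<And>x y. a < x \<Longrightarrow> x < y \<Longrightarrow> g x * (F y - F x) \<le> H y - H x"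
    and hi: "\<And>x y. a < x \<Longrightarrow> x < y \<Longrightarrow> H y - H x \<le> g y * (F y - F x)"
  shows "(H has_real_derivative g t * D) (at t)"
proof -
  let ?q = "\<lambda>F y. (F y - F t) / (y - t)"
  have F': "(?q F \<longlongrightarrow> D) (at t)"
    using F by (simp add: has_field_derivative_iff)
  \<comment> \<open>The increment bounds, used on (t, y) or (y, t), show that the quotient of H
    differs from g t times that of F by at most |g y - g t| times the absolute quotient of F. The
    first factor tends to 0 and the second converges.\<close>
  have "((\<lambda>y. ?q H y - g t * ?q F y) \<longlongrightarrow> 0) (at t)"
  proof (rule Lim_null_comparison)
    have "((\<lambda>y. \<bar>g y - g t\<bar> * \<bar>?q F y\<bar>) \<longlongrightarrow> \<bar>g t - g t\<bar> * \<bar>D\<bar>) (at t)"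
      using g F' by (intro tendsto_intros) (auto simp: isCont_def)
    then show "((\<lambda>y. \<bar>g y - g t\<bar> * \<bar>?q F y\<bar>) \<longlongrightarrow> 0) (at t)" by simp
    have "\<forall>\<^sub>F y in at t. y \<in> {a<..} \<and> y \<noteq> t"
      using \<open>a < t\<close> by (intro eventually_conj eventually_at_in_open' eventually_neq_at_within) auto
    then show "\<forall>\<^sub>F y in at t. norm (?q H y - g t * ?q F y) \<le> \<bar>g y - g t\<bar> * \<bar>?q F y\<bar>"
    proof eventually_elim
      case (elim y)
      have "\<bar>(H y - H t) - g t * (F y - F t)\<bar> \<le> \<bar>(g y - g t) * (F y - F t)\<bar>"
      proof (cases "t < y")
        case True
        then show ?thesis
          using lo[OF \<open>a < t\<close> True] hi[OF \<open>a < t\<close> True] by (simp add: algebra_simps)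
      next
        case False
        then show ?thesis
          using lo[of y t] hi[of y t] elim by (simp add: algebra_simps)
      qed
      then have "\<bar>(H y - H t) - g t * (F y - F t)\<bar> / \<bar>y - t\<bar> \<le> \<bar>(g y - g t) * (F y - F t)\<bar> / \<bar>y - t\<bar>"
        by (rule divide_right_mono) simp
      moreover have "?q H y - g t * ?q F y = ((H y - H t) - g t * (F y - F t)) / (y - t)"
        by (simp only: times_divide_eq_right flip: diff_divide_distrib)
      ultimately show ?case
        by (simp only: real_norm_def abs_mult abs_divide times_divide_eq_right)
    qed
  qed
  from tendsto_add[OF this tendsto_mult_left[OF F', of "g t"]]
  show ?thesis by (simp add: has_field_derivative_iff)
qed

text \<open>The purely analytic part: \<open>\<rho>\<close> is the closed form of R(t) /
  t^(\<alpha>-1) in terms of H and K, and its derivative tends to 2/m.\<close>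

lemma tendsto_renewal_increment:
  fixes F H f :: "real \<Rightarrow> real"
  assumes "\<alpha> > 0" "m > 0" "h > 0"
    and F: "\<And>t. t > 0 \<Longrightarrow> (F has_real_derivative f t) (at t)"
    and H: "\<And>t. t > 0 \<Longrightarrow> (H has_real_derivative t powr \<alpha> * f t) (at t)"
    and Hm: "(H \<longlongrightarrow> m) at_top"
    and tail: "((\<lambda>t. t powr \<alpha> * (1 - F t)) \<longlongrightarrow> 0) at_top"
    and small: "((\<lambda>t. t * (t powr \<alpha> * f t)) \<longlongrightarrow> 0) at_top"
  defines "K \<equiv> \<lambda>t. t powr \<alpha> * (1 - F t) + H t"
  defines "\<rho> \<equiv> \<lambda>t. t * (1 / K t + H t / (K t)\<^sup>2) - t powr (1 - \<alpha>)"
  shows "(K \<longlongrightarrow> m) at_top" and "((\<lambda>t. \<rho> (t + h) - \<rho> t) \<longlongrightarrow> 2 * h / m) at_top"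
proof -
  show Km: "(K \<longlongrightarrow> m) at_top"
    using tendsto_add[OF tail Hm] by (simp add: K_def)
  \<comment> \<open>The term -t^\<alpha> f(t) from the product rule cancels the derivative of H, so
    only the tail 1 - F remains.\<close>
  define K' where "K' = (\<lambda>t. \<alpha> * t powr (\<alpha> - 1) * (1 - F t))"
  define H' where "H' = (\<lambda>t. t powr \<alpha> * f t)"
  \<comment> \<open>The outer factor t is attached to K' and H', whose products with t tend to
    0.\<close>
  define \<rho>' where "\<rho>' = (\<lambda>t. (1 / K t + H t / (K t)\<^sup>2)
    + (- (t * K' t) / (K t)\<^sup>2 + (t * H' t) / (K t)\<^sup>2 - 2 * H t * (t * K' t) / (K t) ^ 3)
    - (1 - \<alpha>) * t powr (- \<alpha>))"
  have K: "(K has_real_derivative K' t) (at t)" if "t > 0" for t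
    unfolding K_def K'_def
    by (rule derivative_eq_intros F[OF that] H[OF that] refl | use that in simp)+
  have ev: "\<forall>\<^sub>F t in at_top. K t > 0"
    by (rule order_tendstoD(1)[OF Km \<open>m > 0\<close>])
  have deriv: "\<forall>\<^sub>F t in at_top. (\<rho> has_real_derivative \<rho>' t) (at t)"
    using ev eventually_gt_at_top[of 0]
  proof eventually_elim
    case (elim t)
    note dK = K[OF elim(2)]
    have dH: "(H has_real_derivative H' t) (at t)"
      using H[OF elim(2)] by (simp add: H'_def)
    have k: "K t \<noteq> 0" using elim by simp
    have "((\<lambda>t. 1 / K t) has_real_derivative - K' t / (K t)\<^sup>2) (at t)"
      using DERIV_divide[OF DERIV_const[of 1] dK k] by (simp add: power2_eq_square)
    moreover have "((\<lambda>t. H t / (K t)\<^sup>2) has_real_derivative H' t / (K t)\<^sup>2 - 2 * H t * K' t / (K t) ^ 3) (at t)"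
    proof -
      have "((\<lambda>t. (K t)\<^sup>2) has_real_derivative 2 * K t * K' t) (at t)"
        using DERIV_power[OF dK, of 2] by (simp add: mult_ac)
      from DERIV_divide[OF dH this] have "((\<lambda>t. H t / (K t)\<^sup>2) has_real_derivative
          (H' t * (K t)\<^sup>2 - H t * (2 * K t * K' t)) / ((K t)\<^sup>2 * (K t)\<^sup>2)) (at t)"
        using k by simp
      then show ?thesis
        by (rule DERIV_cong) (use k in \<open>simp add: field_simps power2_eq_square power3_eq_cube\<close>)
    qed
    ultimately have A: "((\<lambda>t. 1 / K t + H t / (K t)\<^sup>2) has_real_derivative
        - K' t / (K t)\<^sup>2 + (H' t / (K t)\<^sup>2 - 2 * H t * K' t / (K t) ^ 3)) (at t)"
      by (rule DERIV_add)
    from DERIV_diff[OF DERIV_mult[OF DERIV_ident A] has_real_derivative_powr[OF elim(2), of "1 - \<alpha>"]]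
    show ?case
      unfolding \<rho>_def by (rule DERIV_cong) (simp add: \<rho>'_def algebra_simps)
  qed
  have tK': "((\<lambda>t. t * K' t) \<longlongrightarrow> 0) at_top"
  proof (rule Lim_transform_eventually)
    show "((\<lambda>t. \<alpha> * (t powr \<alpha> * (1 - F t))) \<longlongrightarrow> 0) at_top"
      using tendsto_mult_left[OF tail, of \<alpha>] by simp
    show "\<forall>\<^sub>F t in at_top. \<alpha> * (t powr \<alpha> * (1 - F t)) = t * K' t"
      using eventually_gt_at_top[of 0]
      by eventually_elim (simp add: K'_def powr_diff)
  qed
  have tH': "((\<lambda>t. t * H' t) \<longlongrightarrow> 0) at_top"
    using small by (simp add: H'_def)
  \<comment> \<open>Although t^(1-\<alpha>) diverges for \<alpha> < 1, its derivative (1-\<alpha>)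
    t^(-\<alpha>) tends to 0 for every \<alpha> > 0.\<close>
  have pw: "((\<lambda>t. t powr (- \<alpha>)) \<longlongrightarrow> 0) at_top"
    using \<open>\<alpha> > 0\<close> by (intro tendsto_neg_powr filterlim_ident) simp
  have "(\<rho>' \<longlongrightarrow> (1 / m + m / m\<^sup>2) + (- 0 / m\<^sup>2 + 0 / m\<^sup>2 - 2 * m * 0 / m ^ 3) - (1 - \<alpha>) * 0) at_top"
    unfolding \<rho>'_def
    by (intro tendsto_intros Km Hm tK' tH' pw) (use \<open>m > 0\<close> in simp_all)
  then have "(\<rho>' \<longlongrightarrow> 2 / m) at_top"
    using \<open>m > 0\<close> by (simp add: power2_eq_square)
  from tendsto_diff_shift_of_deriv[OF deriv this \<open>h > 0\<close>]
  show "((\<lambda>t. \<rho> (t + h) - \<rho> t) \<longlongrightarrow> 2 * h / m) at_top"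
    by (simp add: mult.commute)
qed

section \<open>The density, the truncated moment and the tail of the step law\<close>

lemma cdf_derivative_nonneg:
  assumes "prob_space \<nu>" "sets \<nu> = sets borel"
    and "((\<lambda>s. measure \<nu> {0..s}) has_real_derivative D) (at t)"
  shows "0 \<le> D"
proof -
  interpret prob_space \<nu> by fact
  have "mono_on UNIV (\<lambda>s. measure \<nu> {0..s})"
    using assms(2) by (intro mono_onI finite_measure_mono) auto
  then show ?thesis
    using assms(3) by (rule mono_on_imp_deriv_nonneg) simp
qed

text \<open>On (0, \<infinity>) \<open>f\<close> is the pointwise limit of difference quotients of a
  monotone, hence Borel, function. The indicator removes the other points, where \<open>f\<close> is
  arbitrary.\<close>

lemma cdf_derivative_measurable:
  assumes "prob_space \<nu>" "sets \<nu> = sets borel"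
    and deriv: "\<And>t. t > 0 \<Longrightarrow> ((\<lambda>s. measure \<nu> {0..s}) has_real_derivative f t) (at t)"
  shows "(\<lambda>x. f x * indicator {0<..} x) \<in> borel_measurable borel"
proof -
  interpret prob_space \<nu> by fact
  let ?F = "\<lambda>s. measure \<nu> {0..s}"
  have "mono ?F"
    using assms(2) by (intro monoI finite_measure_mono) auto
  then have [measurable]: "?F \<in> borel_measurable borel"
    by (rule borel_measurable_mono)
  let ?h = "\<lambda>n. inverse (real (Suc n))"
  show ?thesis
  proof (rule borel_measurable_LIMSEQ_real)
    show "(\<lambda>x. (?F (x + ?h n) - ?F x) / ?h n * indicator {0<..} x) \<in> borel_measurable borel" for n
      by measurable
    fix x :: real
    show "(\<lambda>n. (?F (x + ?h n) - ?F x) / ?h n * indicator {0<..} x) \<longlonglongrightarrow> f x * indicator {0<..} x"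
    proof (cases "x > 0")
      case True
      have "filterlim ?h (at 0) sequentially"
        using LIMSEQ_inverse_real_of_nat by (auto simp: filterlim_at)
      from filterlim_compose[OF deriv[OF True, unfolded DERIV_def] this]
      show ?thesis using True by simp
    qed simp
  qed
qed

text \<open>The smallness condition of the theorem is stated through \<open>f\<close>, whereas
  limits and increments of H are read off from integrals against \<nu>; this is the bridge.\<close>

lemma trunc_moment_eq_integral:
  assumes "\<alpha> > 0" "\<nu> \<in> prob_nonneg"
    and deriv: "\<And>t. t > 0 \<Longrightarrow> ((\<lambda>s. measure \<nu> {0..s}) has_real_derivative f t) (at t)"
    and dens: "\<nu> = density lborel (\<lambda>x. ennreal (f x) * indicator {0<..} x)"
  shows "trunc_moment \<alpha> f t = (\<integral>x. x powr \<alpha> * indicator {0..t} x \<partial>\<nu>)"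
proof -
  note \<nu> = prob_nonnegD[OF assms(2)]
  \<comment> \<open>Ensures that \<open>ennreal\<close> does not cut off negative values of
    \<open>f\<close> in the density.\<close>
  have nonneg: "0 \<le> f x * indicator {0<..} x" for x
    using cdf_derivative_nonneg[OF \<nu>(3,2) deriv, of x] by (auto simp: indicator_def)
  have "\<nu> = density lborel (\<lambda>x. ennreal (f x * indicator {0<..} x))"
    unfolding dens by (rule arg_cong[of _ _ "density lborel"]) (auto simp: indicator_def)
  then have "(\<integral>x. x powr \<alpha> * indicator {0..t} x \<partial>\<nu>) =
      (\<integral>x. (f x * indicator {0<..} x) *\<^sub>R (x powr \<alpha> * indicator {0..t} x) \<partial>lborel)"
    using integral_density[of "\<lambda>x. x powr \<alpha> * indicator {0..t} x" lborel "\<lambda>x. f x * indicator {0<..} x"]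
      cdf_derivative_measurable[OF \<nu>(3,2) deriv] nonneg by simp
  \<comment> \<open>At the point 0 both integrands vanish because \<open>0 powr \<alpha>\<close> is
    0, whatever value \<open>f\<close> has there.\<close>
  also have "\<dots> = trunc_moment \<alpha> f t"
    unfolding trunc_moment_def set_lebesgue_integral_def
    by (rule Bochner_Integration.integral_cong) (auto simp: indicator_def)
  finally show ?thesis ..
qed

text \<open>Absence of mass at 0 gives m > 0, dominated convergence gives the limit of H, the tail
  is bounded by m - H(t), and the derivative comes from comparing increments of H with those of
  F.\<close>

lemma moment_tendsto:
  assumes "\<alpha> > 0" "\<nu> \<in> prob_nonneg" "moment \<alpha> \<nu> < \<infinity>"
    and deriv: "\<And>t. t > 0 \<Longrightarrow> ((\<lambda>s. measure \<nu> {0..s}) has_real_derivative f t) (at t)"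
    and dens: "AE x in \<nu>. 0 < x"
  defines "m \<equiv> enn2real (moment \<alpha> \<nu>)"
    and "F \<equiv> \<lambda>t. measure \<nu> {0..t}"
    and "H \<equiv> \<lambda>t. \<integral>x. x powr \<alpha> * indicator {0..t} x \<partial>\<nu>"
  shows "m > 0" "(H \<longlongrightarrow> m) at_top" "((\<lambda>t. t powr \<alpha> * (1 - F t)) \<longlongrightarrow> 0) at_top"
    "t > 0 \<Longrightarrow> (H has_real_derivative t powr \<alpha> * f t) (at t)"
proof -
  note \<nu> = prob_nonnegD[OF assms(2)]
  interpret prob_space \<nu> by (rule \<nu>(3))
  note [measurable_cong] = \<nu>(2)
  have mom: "moment \<alpha> \<nu> = (\<integral>\<^sup>+x. ennreal (x powr \<alpha>) \<partial>\<nu>)"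
    unfolding moment_def
    by (rule nn_integral_cong_AE) (use \<nu>(4) in eventually_elim, simp)
  have int: "integrable \<nu> (\<lambda>x. x powr \<alpha>)"
    using assms(3) unfolding mom by (intro integrableI_nonneg) auto
  have m: "m = (\<integral>x. x powr \<alpha> \<partial>\<nu>)"
    unfolding m_def mom by (subst nn_integral_eq_integral[OF int]) auto
  have intI: "integrable \<nu> (\<lambda>x. x powr \<alpha> * indicator A x)" if "A \<in> sets borel" for A
    using that \<nu>(2) by (intro integrable_real_mult_indicator int) auto
  show "m > 0"
  proof (rule ccontr)
    assume "\<not> m > 0"
    moreover have "m \<ge> 0" by (simp add: m_def)
    ultimately have "m = 0" by linarith
    then have "(\<integral>x. x powr \<alpha> \<partial>\<nu>) = 0" using m by simp
    then have "AE x in \<nu>. x powr \<alpha> = 0"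
      using integral_nonneg_eq_0_iff_AE[OF int] by simp
    with dens have "AE x in \<nu>. False"
      by eventually_elim simp
    then show False by simp
  qed
  show Hm: "(H \<longlongrightarrow> m) at_top"
    unfolding H_def m
  proof (rule integral_dominated_convergence_at_top[OF _ _ int])
    show "AE x in \<nu>. ((\<lambda>t. x powr \<alpha> * indicator {0..t} x) \<longlongrightarrow> x powr \<alpha>) at_top"
      using \<nu>(4)
    proof eventually_elim
      case (elim x)
      have "\<forall>\<^sub>F t in at_top. x powr \<alpha> = x powr \<alpha> * indicator {0..t} x"
        using eventually_ge_at_top[of x] by eventually_elim (use elim in simp)
      then show ?case by (rule Lim_transform_eventually[OF tendsto_const])
    qed
    show "\<forall>\<^sub>F t in at_top. AE x in \<nu>. norm (x powr \<alpha> * indicator {0..t} x) \<le> x powr \<alpha>"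
      by (intro always_eventually allI AE_I2) (simp add: indicator_def)
  qed measurable
  show "((\<lambda>t. t powr \<alpha> * (1 - F t)) \<longlongrightarrow> 0) at_top"
  proof (rule tendsto_sandwich[OF _ _ tendsto_const])
    show "((\<lambda>t. m - H t) \<longlongrightarrow> 0) at_top"
      using tendsto_diff[OF tendsto_const[of m] Hm] by simp
    show "\<forall>\<^sub>F t in at_top. 0 \<le> t powr \<alpha> * (1 - F t)"
      by (simp add: F_def)
    show "\<forall>\<^sub>F t in at_top. t powr \<alpha> * (1 - F t) \<le> m - H t"
      using eventually_gt_at_top[of 0]
    proof eventually_elim
      case (elim t)
      have int1: "integrable \<nu> (\<lambda>x. indicator {0..t} x :: real)"
        by (rule integrable_const_bound[where B = 1]) auto
      have "t powr \<alpha> * (1 - F t) = (\<integral>x. t powr \<alpha> * (1 - indicator {0..t} x) \<partial>\<nu>)"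
        using int1 integral_indicator_Icc[OF assms(2), of t] prob_space by (simp add: F_def del: integral_indicator Bochner_Integration.integral_indicator)
      \<comment> \<open>A Markov-type bound: on [0, t] both integrands vanish, and beyond t the
        inequality is t^\<alpha> \<le> x^\<alpha>.\<close>
      also have "\<dots> \<le> (\<integral>x. x powr \<alpha> - x powr \<alpha> * indicator {0..t} x \<partial>\<nu>)"
      proof (rule integral_mono_AE)
        show "AE x in \<nu>. t powr \<alpha> * (1 - indicator {0..t} x) \<le> x powr \<alpha> - x powr \<alpha> * indicator {0..t} x"
          using \<nu>(4) by eventually_elim (use elim assms(1) in \<open>auto simp: indicator_def intro!: powr_mono2\<close>)
      qed (use int1 int intI in auto)
      also have "\<dots> = m - H t"
        using int intI by (simp add: m H_def)
      finally show ?case .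
    qed
  qed
  assume "t > 0"
  \<comment> \<open>Both increments are integrals over (x, y], where the weight z^\<alpha> lies
    between x^\<alpha> and y^\<alpha>.\<close>
  have diff: "H y - H x = (\<integral>z. z powr \<alpha> * indicator {x<..y} z \<partial>\<nu>)"
    "F y - F x = (\<integral>z. indicator {x<..y} z \<partial>\<nu>)" if "0 < x" "x < y" for x y
  proof -
    have ind: "indicator {x<..y} z = indicator {0..y} z - (indicator {0..x} z :: real)" for z
      using that by (auto simp: indicator_def)
    show "H y - H x = (\<integral>z. z powr \<alpha> * indicator {x<..y} z \<partial>\<nu>)"
      unfolding ind right_diff_distrib H_def using intI by simp
    have int1: "integrable \<nu> (\<lambda>x. indicator {0..t} x :: real)" for t
      by (rule integrable_const_bound[where B = 1]) auto
    show "F y - F x = (\<integral>z. indicator {x<..y} z \<partial>\<nu>)"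
      unfolding ind F_def integral_indicator_Icc[OF assms(2), symmetric]
      by (rule Bochner_Integration.integral_diff[OF int1 int1, symmetric])
  qed
  have int2: "integrable \<nu> (\<lambda>z. c * indicator {x<..y} z :: real)" for c x y
    by (rule integrable_const_bound[where B = "\<bar>c\<bar>"]) (auto simp: indicator_def)
  show "(H has_real_derivative t powr \<alpha> * f t) (at t)"
  proof (rule has_real_derivative_of_weighted_increments[OF deriv[OF \<open>t > 0\<close>, folded F_def] _ \<open>t > 0\<close>])
    show "isCont (\<lambda>t. t powr \<alpha>) t"
      using \<open>t > 0\<close> by (intro continuous_intros) auto
    fix x y :: real assume xy: "0 < x" "x < y"
    have "x powr \<alpha> * (F y - F x) = (\<integral>z. x powr \<alpha> * indicator {x<..y} z \<partial>\<nu>)"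
      unfolding diff[OF xy] by (rule integral_mult_right_zero[symmetric])
    also have "\<dots> \<le> H y - H x"
      unfolding diff[OF xy] by (rule integral_mono[OF int2 intI])
        (use xy assms(1) in \<open>auto simp: indicator_def intro!: powr_mono2\<close>)
    finally show "x powr \<alpha> * (F y - F x) \<le> H y - H x" .
    have "H y - H x \<le> (\<integral>z. y powr \<alpha> * indicator {x<..y} z \<partial>\<nu>)"
      unfolding diff[OF xy] by (rule integral_mono[OF intI int2])
        (use xy assms(1) in \<open>auto simp: indicator_def intro!: powr_mono2\<close>)
    also have "\<dots> = y powr \<alpha> * (F y - F x)"
      unfolding diff[OF xy] by (rule integral_mult_right_zero)
    finally show "H y - H x \<le> y powr \<alpha> * (F y - F x)" .
  qed
qed

section \<open>The limit of the normalised renewal increments\<close>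

theorem theorem5:
  fixes \<alpha> :: real and \<nu> :: "real measure" and f :: "real \<Rightarrow> real"
    and M :: "'a measure" and S :: "nat \<Rightarrow> 'a \<Rightarrow> real"
  assumes "\<alpha> > 0"
    and "\<nu> \<in> prob_nonneg"
    and "kendall_random_walk \<alpha> \<nu> M S"
    and "\<And>t. t > 0 \<Longrightarrow> ((\<lambda>s. measure \<nu> {0..s}) has_real_derivative f t) (at t)"
    and "\<nu> = density lborel (\<lambda>x. ennreal (f x) * indicator {0<..} x)"
    and "moment \<alpha> \<nu> < \<infinity>"
    and "((\<lambda>x. x * deriv (trunc_moment \<alpha> f) x) \<longlongrightarrow> 0) at_top"
  shows "\<forall>h>0. ((\<lambda>t. enn2ereal (renewal_function M S (t + h)) / ereal ((t + h) powr (\<alpha> - 1))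
                    - enn2ereal (renewal_function M S t) / ereal (t powr (\<alpha> - 1)))
                 \<longlongrightarrow> ereal (2 * h / enn2real (moment \<alpha> \<nu>))) at_top"
proof (intro allI impI)
  fix h :: real assume "h > 0"
  define m where "m = enn2real (moment \<alpha> \<nu>)"
  define F where "F = (\<lambda>t. measure \<nu> {0..t})"
  define H where "H = (\<lambda>t. \<integral>x. x powr \<alpha> * indicator {0..t} x \<partial>\<nu>)"
  define K where "K = (\<lambda>t. t powr \<alpha> * (1 - F t) + H t)"
  define \<rho> where "\<rho> = (\<lambda>t. t * (1 / K t + H t / (K t)\<^sup>2) - t powr (1 - \<alpha>))"
  note \<nu> = prob_nonnegD[OF assms(2)]
  have meas: "(\<lambda>x. ennreal (f x) * indicator {0<..} x) \<in> borel_measurable lborel"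
  proof -
    have "(\<lambda>x. ennreal (f x) * indicator {0<..} x) = (\<lambda>x. ennreal (f x * indicator {0<..} x))"
      by (auto simp: indicator_def)
    then show ?thesis
      using cdf_derivative_measurable[OF \<nu>(3,2) assms(4)] by simp
  qed
  have pos: "AE x in \<nu>. 0 < x"
    unfolding assms(5) by (subst AE_density[OF meas]) (rule AE_I2, auto simp: indicator_def split: if_splits)
  have mt: "m > 0" "(H \<longlongrightarrow> m) at_top" "((\<lambda>t. t powr \<alpha> * (1 - F t)) \<longlongrightarrow> 0) at_top"
    "\<And>t. t > 0 \<Longrightarrow> (H has_real_derivative t powr \<alpha> * f t) (at t)"
    unfolding m_def F_def H_def by (rule moment_tendsto[OF assms(1,2,6,4) pos]; assumption)+
  have dF: "(F has_real_derivative f t) (at t)" if "t > 0" for t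
    using assms(4)[OF that] by (simp add: F_def)
  have tm: "trunc_moment \<alpha> f = H"
    unfolding H_def by (rule ext) (rule trunc_moment_eq_integral[OF assms(1,2,4,5)])
  \<comment> \<open>H is differentiable at every positive t, so \<open>deriv\<close> there is its
    true derivative t^\<alpha> f(t).\<close>
  have small: "((\<lambda>t. t * (t powr \<alpha> * f t)) \<longlongrightarrow> 0) at_top"
  proof (rule Lim_transform_eventually[OF assms(7)])
    show "\<forall>\<^sub>F t in at_top. t * deriv (trunc_moment \<alpha> f) t = t * (t powr \<alpha> * f t)"
      using eventually_gt_at_top[of 0]
      by eventually_elim (simp add: tm DERIV_imp_deriv[OF mt(4)])
  qed
  have lim: "(K \<longlongrightarrow> m) at_top" "((\<lambda>t. \<rho> (t + h) - \<rho> t) \<longlongrightarrow> 2 * h / m) at_top"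
    unfolding \<rho>_def K_def
    by (rule tendsto_renewal_increment[OF assms(1) mt(1) \<open>h > 0\<close> dF mt(4,2,3) small]; assumption)+
  have "\<forall>\<^sub>F t in at_top. K t > 0"
    by (rule order_tendstoD(1)[OF lim(1) mt(1)])
  \<comment> \<open>K(t) > 0 means G < 1, so from some t on the renewal function is finite and the
    closed form applies.\<close>
  then have R: "\<forall>\<^sub>F t in at_top. enn2ereal (renewal_function M S t) / ereal (t powr (\<alpha> - 1)) = ereal (\<rho> t)"
    using eventually_gt_at_top[of 0]
  proof eventually_elim
    case (elim t)
    define Q where "Q = (\<integral>x. trunc_power \<alpha> t x \<partial>\<nu>)"
    define G where "G = F t - Q"
    have "Q = (\<integral>x. x powr \<alpha> * indicator {0..t} x / t powr \<alpha> \<partial>\<nu>)"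
      unfolding Q_def by (rule Bochner_Integration.integral_cong)
        (use elim in \<open>auto simp: trunc_power_def powr_divide indicator_def\<close>)
    then have Q: "Q = H t / t powr \<alpha>"
      by (simp add: H_def)
    have G: "1 - G = K t / t powr \<alpha>"
      using elim by (simp add: G_def Q K_def field_simps)
    have "K t / t powr \<alpha> > 0" using elim by simp
    then have "G < 1" unfolding G[symmetric] by simp
    have "0 \<le> Q" "0 \<le> G"
      using integral_trunc_power_le[OF assms(1) elim(2) assms(2)] by (auto simp: Q_def G_def F_def)
    then have nonneg: "0 \<le> G / (1 - G) + Q / (1 - G)\<^sup>2"
      using \<open>G < 1\<close> by simp
    have "renewal_function M S t = ennreal (G / (1 - G) + Q / (1 - G)\<^sup>2)"
      using renewal_function_closed_form[OF assms(1-3) elim(2)] \<open>G < 1\<close> by (simp add: G_def F_def Q_def)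
    moreover have "(G / (1 - G) + Q / (1 - G)\<^sup>2) / t powr (\<alpha> - 1) = \<rho> t"
    proof -
      \<comment> \<open>Writing G as 1 - (1 - G) produces a summand -1, which becomes
        -t^(1-\<alpha>) after division by t^(\<alpha>-1).\<close>
      have "G / (1 - G) = (1 - (1 - G)) / (1 - G)" by simp
      also have "\<dots> = t powr \<alpha> / K t - 1"
        unfolding G using elim by (simp add: field_simps)
      finally have "G / (1 - G) = t powr \<alpha> / K t - 1" .
      moreover have "Q / (1 - G)\<^sup>2 = t powr \<alpha> * H t / (K t)\<^sup>2"
        unfolding G using elim by (simp add: Q field_simps power2_eq_square)
      ultimately have "(G / (1 - G) + Q / (1 - G)\<^sup>2) / t powr (\<alpha> - 1) =
          (t powr \<alpha> / K t - 1 + t powr \<alpha> * H t / (K t)\<^sup>2) / t powr (\<alpha> - 1)"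
        by simp
      also have "\<dots> = t powr \<alpha> / t powr (\<alpha> - 1) * (1 / K t + H t / (K t)\<^sup>2) - 1 / t powr (\<alpha> - 1)"
        by (simp add: add_divide_distrib diff_divide_distrib distrib_left mult_ac)
      also have "t powr \<alpha> / t powr (\<alpha> - 1) = t"
        using elim by (simp flip: powr_diff)
      also have "1 / t powr (\<alpha> - 1) = t powr (1 - \<alpha>)"
        using elim by (simp add: powr_minus_divide[symmetric])
      finally show ?thesis by (simp add: \<rho>_def)
    qed
    ultimately show ?case
      using elim nonneg by (simp add: enn2ereal_ennreal)
  qed
  have R': "\<forall>\<^sub>F t in at_top. enn2ereal (renewal_function M S (t + h)) / ereal ((t + h) powr (\<alpha> - 1)) = ereal (\<rho> (t + h))"
    by (rule eventually_compose_filterlim[OF R]) (rule filterlim_tendsto_add_at_top[OF tendsto_const filterlim_ident, of h, unfolded add.commute[of h]])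
  have "((\<lambda>t. ereal (\<rho> (t + h) - \<rho> t)) \<longlongrightarrow> ereal (2 * h / m)) at_top"
    using lim(2) by simp
  then show "((\<lambda>t. enn2ereal (renewal_function M S (t + h)) / ereal ((t + h) powr (\<alpha> - 1))
                    - enn2ereal (renewal_function M S t) / ereal (t powr (\<alpha> - 1)))
                 \<longlongrightarrow> ereal (2 * h / enn2real (moment \<alpha> \<nu>))) at_top"
    unfolding m_def
  proof (rule Lim_transform_eventually)
    show "\<forall>\<^sub>F t in at_top. ereal (\<rho> (t + h) - \<rho> t) =
      enn2ereal (renewal_function M S (t + h)) / ereal ((t + h) powr (\<alpha> - 1))
                    - enn2ereal (renewal_function M S t) / ereal (t powr (\<alpha> - 1))"
      using R R' by eventually_elim simp
  qed
qed

end
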